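(* Let $N\ge 1$ and let $\Omega_1,\Omega_2\subset\mathbb{R}^N$ be bounded, connected, open sets with $C^1$ boundary and $\overline{\Omega_1}\cap\overline{\Omega_2}=\emptyset$. Let $\mu^-$ be a nonnegative finite Borel measure on $[0,1]$ with $\mu^-((0,1))\neq 0$. For a bounded open set $U$, define $$\lambda(U,\mu^-)=\min_{u\in H^1_0(U)\setminus\{0\}}\frac{\int_U|\nabla u|^2\,dx}{\int_{[0,1)}[u]_s^2\,d\mu^-(s)}.$$ Assume that, for $j\in\{1,2\}$, the eigenvalue $\lambda(\Omega_j,\mu^-)$ admits an eigenfunction $u_{\Omega_j}$ which is positive in $\Omega_j$. Then: - $\lambda(\Omega_1\cup\Omega_2,\mu^-)<\min\{\lambda(\Omega_1,\mu^-),\lambda(\Omega_2,\mu^-)\}$; - no linear combination $c_1u_{\Omega_1}+c_2u_{\Omega_2}$ with $c_1,c_2\ge 0$ is an eigenfunction corresponding to $\lambda(\Omega_1\cup\Omega_2,\mu^-)$.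
   Context: Functions in $H^1_0(U)$ are extended by zero outside $U$. For $s\in(0,1)$, the seminorm is $$[u]_s^2=c_{N,s}\iint_{\mathbb{R}^{2N}}\frac{|u(x)-u(y)|^2}{|x-y|^{N+2s}}\,dx\,dy,\qquad c_{N,s}=\frac{2^{2s-1}\Gamma(\frac{N+2s}{2})}{\pi^{N/2}\Gamma(2-s)}s(1-s),$$ and $[u]_0=\|u\|_{L^2(\mathbb{R}^N)}$. The forms $\langle u,v\rangle_s$ are the associated bilinear forms ($\langle u,v\rangle_0=\int uv$). The fractional Laplacian is $$(-\Delta)^su(x)=c_{N,s}\int\frac{2u(x)-u(x+y)-u(x-y)}{|y|^{N+2s}}\,dy,\qquad (-\Delta)^0u=u.$$ An eigenfunction corresponding to $\lambda$ in $U$ for the problem $-\Delta u=\lambda\int_{[0,1)}(-\Delta)^su\,d\mu^-(s)$ in $U$, $u=0$ outside $U$, is $u\in H^1_0(U)\setminus\{0\}$ with $$\int_U\nabla u\cdot\nabla v=\lambda\int_{[0,1)}\langle u,v\rangle_s\,d\mu^-(s)\quad\text{for all } v\in C_c^\infty(U).$$ *)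

theory Defs
  imports "HOL-Analysis.Analysis"
begin

definition partial :: "'a::euclidean_space \<Rightarrow> ('a \<Rightarrow> real) \<Rightarrow> 'a \<Rightarrow> real" where
  "partial b f x = deriv (\<lambda>t. f (x + t *\<^sub>R b)) 0"

definition cgrad :: "('a::euclidean_space \<Rightarrow> real) \<Rightarrow> 'a \<Rightarrow> 'a" where
  "cgrad f x = (\<Sum>b\<in>Basis. partial b f x *\<^sub>R b)"

definition smooth_fun :: "('a::euclidean_space \<Rightarrow> real) \<Rightarrow> bool" where
  "smooth_fun f \<longleftrightarrow> (\<forall>bs. set bs \<subseteq> Basis \<longrightarrow> (\<forall>x. foldr partial bs f differentiable (at x)))"

definition test_fun :: "'a::euclidean_space set \<Rightarrow> ('a \<Rightarrow> real) \<Rightarrow> bool" where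
  "test_fun U f \<longleftrightarrow> smooth_fun f \<and> compact (closure {x. f x \<noteq> 0}) \<and> closure {x. f x \<noteq> 0} \<subseteq> U"

definition weak_grad :: "('a::euclidean_space \<Rightarrow> real) \<Rightarrow> ('a \<Rightarrow> 'a) \<Rightarrow> bool" where
  "weak_grad u g \<longleftrightarrow> g \<in> borel_measurable lebesgue \<and>
     (\<forall>\<phi> b. test_fun UNIV \<phi> \<and> b \<in> Basis \<longrightarrow>
        integral\<^sup>L lebesgue (\<lambda>x. u x * partial b \<phi> x) = - integral\<^sup>L lebesgue (\<lambda>x. (g x \<bullet> b) * \<phi> x))"

text \<open>H^1_0(U), functions extended by zero: closure of C_c^infinity(U) in the H^1 norm.\<close>
definition H10 :: "'a::euclidean_space set \<Rightarrow> ('a \<Rightarrow> real) set" where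
  "H10 U = {u. u \<in> borel_measurable lebesgue \<and> integrable lebesgue (\<lambda>x. (u x)\<^sup>2) \<and>
     (\<exists>g. weak_grad u g \<and> integrable lebesgue (\<lambda>x. (norm (g x))\<^sup>2) \<and>
       (\<exists>\<phi>::nat \<Rightarrow> 'a \<Rightarrow> real. (\<forall>k. test_fun U (\<phi> k)) \<and>
          (\<lambda>k. integral\<^sup>L lebesgue (\<lambda>x. (\<phi> k x - u x)\<^sup>2)) \<longlonglongrightarrow> 0 \<and>
          (\<lambda>k. integral\<^sup>L lebesgue (\<lambda>x. (norm (cgrad (\<phi> k) x - g x))\<^sup>2)) \<longlonglongrightarrow> 0))}"

text \<open>The (a.e. unique) weak gradient of u.\<close>
definition wgrad :: "('a::euclidean_space \<Rightarrow> real) \<Rightarrow> 'a \<Rightarrow> 'a" where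
  "wgrad u = (SOME g. weak_grad u g \<and> integrable lebesgue (\<lambda>x. (norm (g x))\<^sup>2))"

definition nonzero_fun :: "('a::euclidean_space \<Rightarrow> real) \<Rightarrow> bool" where
  "nonzero_fun u \<longleftrightarrow> \<not> (AE x in lebesgue. u x = 0)"

definition cNs :: "nat \<Rightarrow> real \<Rightarrow> real" where
  "cNs n t = 2 powr (2 * t - 1) * Gamma ((real n + 2 * t) / 2) / (pi powr (real n / 2) * Gamma (2 - t)) * t * (1 - t)"

definition frac_form :: "real \<Rightarrow> ('a::euclidean_space \<Rightarrow> real) \<Rightarrow> ('a \<Rightarrow> real) \<Rightarrow> real" where
  "frac_form s u v = (if s = 0 then integral\<^sup>L lebesgue (\<lambda>x. u x * v x)
     else cNs DIM('a) s * integral\<^sup>L (lebesgue \<Otimes>\<^sub>M lebesgue)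
        (\<lambda>(x,y). (u x - u y) * (v x - v y) / norm (x - y) powr (real DIM('a) + 2 * s)))"

definition mu_form :: "real measure \<Rightarrow> ('a::euclidean_space \<Rightarrow> real) \<Rightarrow> ('a \<Rightarrow> real) \<Rightarrow> real" where
  "mu_form \<mu> u v = (LINT s:{0..<1}|\<mu>. frac_form s u v)"

definition dirichlet :: "'a::euclidean_space set \<Rightarrow> ('a \<Rightarrow> real) \<Rightarrow> real" where
  "dirichlet U u = (LINT x:U|lebesgue. (norm (wgrad u x))\<^sup>2)"

definition lam :: "'a::euclidean_space set \<Rightarrow> real measure \<Rightarrow> real" where
  "lam U \<mu> = Inf {dirichlet U u / mu_form \<mu> u u | u. u \<in> H10 U \<and> nonzero_fun u}"

definition eigenfunction :: "'a::euclidean_space set \<Rightarrow> real measure \<Rightarrow> real \<Rightarrow> ('a \<Rightarrow> real) \<Rightarrow> bool" where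
  "eigenfunction U \<mu> lm u \<longleftrightarrow> u \<in> H10 U \<and> nonzero_fun u \<and>
     (\<forall>v. test_fun U v \<longrightarrow>
        (LINT x:U|lebesgue. wgrad u x \<bullet> cgrad v x) = lm * mu_form \<mu> u v)"

definition C1_boundary :: "'a::euclidean_space set \<Rightarrow> bool" where
  "C1_boundary U \<longleftrightarrow> (\<forall>x\<in>frontier U. \<exists>r>0. \<exists>(\<rho>::'a \<Rightarrow> real) \<rho>'.
      (\<forall>y\<in>ball x r. (\<rho> has_derivative \<rho>' y) (at y)) \<and>
      (\<forall>b\<in>Basis. continuous_on (ball x r) (\<lambda>y. \<rho>' y b)) \<and> \<rho>' x \<noteq> (\<lambda>_. 0) \<and>
      U \<inter> ball x r = {y\<in>ball x r. \<rho> y < 0})"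

end

(*
The form of (-Delta)^s is negative on a pair of nonnegative functions with disjoint supports:
(u1(x) - u1(y)) (u2(x) - u2(y)) = - u1(x) u2(y) - u1(y) u2(x) almost everywhere. Write M(u,v) for the
integral of these forms against mu, so M(u1,u2) < 0. If lambda_1 <= lambda_2, the competitor
u1 - t u2 has Dirichlet energy lambda_1 M(u1,u1) + t^2 lambda_2 M(u2,u2), while its denominator gains
2 t |M(u1,u2)|, so for small t > 0 the quotient drops below lambda_1. If c1 u1 + c2 u2 were an
eigenfunction for the smaller value lambda, testing with u1 would give
c1 (lambda_1 - lambda) M(u1,u1) = lambda c2 M(u1,u2) <= 0, hence c1 = 0, and likewise c2 = 0.

The analysis rests on the translation estimate |u(. + z) - u| <= |z| |grad u| in L^2. It bounds
[u]_s^2 by the H^1 norm uniformly in s, and, applied to a translation moving the domain off itself,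
it shows that a function in H^1_0 of a bounded set vanishes if its gradient does.
*)
theory Submission
  imports Defs
begin

section \<open>Square-integrable functions\<close>


text \<open>The statement speaks of \<open>wgrad\<close>, a weak gradient picked by choice, and the
  weak equation holds against test functions only; these two obstacles shape the proof. The first is
  removed by uniqueness of square-integrable weak gradients, which needs a supply of test functions;
  they are built explicitly from exp(-1/x). The second calls for continuity of M in the H^1 norm,
  because u1 and u2 themselves have to be inserted in the weak equation. Continuity rests on a bound
  of [u]_s^2 that does not degenerate at the ends: the kernel integral is bounded by terms of size
  1/s and 1/(1 - s), and the factor s (1 - s) of the normalizing constant cancels both. The
  vanishing criterion yields lambda_j > 0 and M(u_j,u_j) > 0: testing the equation for u_j with u_j
  gives |grad u_j|^2 = lambda_j M(u_j,u_j), whose left side is nonzero. Positivity cannot be read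
  off the quotient, since division by zero yields 0 in HOL.\<close>

definition L2 :: "'m measure \<Rightarrow> ('m \<Rightarrow> 'b::euclidean_space) \<Rightarrow> bool" where
  "L2 M f \<longleftrightarrow> f \<in> borel_measurable M \<and> integrable M (\<lambda>x. (norm (f x))\<^sup>2)"

text \<open>Generic in measure and codomain: it serves functions and gradients on
  \<open>lborel\<close> and \<open>lebesgue\<close>, and difference quotients on the product
  space.\<close>

definition ip :: "'m measure \<Rightarrow> ('m \<Rightarrow> 'b::euclidean_space) \<Rightarrow> ('m \<Rightarrow> 'b) \<Rightarrow> real" where
  "ip M f g = (\<integral>x. f x \<bullet> g x \<partial>M)"

definition nsq :: "'m measure \<Rightarrow> ('m \<Rightarrow> 'b::euclidean_space) \<Rightarrow> real" where
  "nsq M f = (\<integral>x. (norm (f x))\<^sup>2 \<partial>M)"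

lemma L2_measurable: "L2 M f \<Longrightarrow> f \<in> borel_measurable M"
  by (simp add: L2_def)

lemma L2_integrable_sq: "L2 M f \<Longrightarrow> integrable M (\<lambda>x. (norm (f x))\<^sup>2)"
  by (simp add: L2_def)

lemma nsq_nonneg [simp]: "0 \<le> nsq M f"
  by (simp add: nsq_def)

lemma nsq_ip: "nsq M f = ip M f f"
  by (simp add: nsq_def ip_def power2_norm_eq_inner)

lemma ip_commute: "ip M f g = ip M g f"
  by (simp add: ip_def inner_commute)

lemma L2_integrable_inner:
  assumes "L2 M f" "L2 M g"
  shows "integrable M (\<lambda>x. f x \<bullet> g x)"
proof (rule Bochner_Integration.integrable_bound)
  show "integrable M (\<lambda>x. (norm (f x))\<^sup>2 + (norm (g x))\<^sup>2)"
    using assms by (auto simp: L2_def)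
  show "(\<lambda>x. f x \<bullet> g x) \<in> borel_measurable M"
    using assms by (auto simp: L2_def)
  show "AE x in M. norm (f x \<bullet> g x) \<le> norm ((norm (f x))\<^sup>2 + (norm (g x))\<^sup>2)"
  proof (rule AE_I2)
    fix x
    have "\<bar>f x \<bullet> g x\<bar> \<le> norm (f x) * norm (g x)"
      by (rule Cauchy_Schwarz_ineq2)
    also have "\<dots> \<le> (norm (f x))\<^sup>2 + (norm (g x))\<^sup>2"
      using sum_squares_bound[of "norm (f x)" "norm (g x)"] mult_nonneg_nonneg[OF norm_ge_zero norm_ge_zero, of "f x" "g x"]
      by linarith
    finally show "norm (f x \<bullet> g x) \<le> norm ((norm (f x))\<^sup>2 + (norm (g x))\<^sup>2)"
      by simp
  qed
qed

lemma L2_scale: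
  assumes "L2 M f" shows "L2 M (\<lambda>x. a *\<^sub>R f x)"
  using assms by (auto simp: L2_def power_mult_distrib)

lemma nsq_scale: "nsq M (\<lambda>x. a *\<^sub>R f x) = a\<^sup>2 * nsq M f"
  by (simp add: nsq_def power_mult_distrib)

lemma L2_add:
  assumes "L2 M f" "L2 M g" shows "L2 M (\<lambda>x. f x + g x)"
proof -
  have "integrable M (\<lambda>x. (norm (f x))\<^sup>2 + 2 * (f x \<bullet> g x) + (norm (g x))\<^sup>2)"
    using assms L2_integrable_inner[OF assms] by (auto simp: L2_def)
  then have "integrable M (\<lambda>x. (norm (f x + g x))\<^sup>2)"
    by (simp add: power2_norm_eq_inner inner_add_left inner_add_right inner_commute algebra_simps)
  then show ?thesis
    using assms by (auto simp: L2_def)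
qed

lemma L2_diff:
  assumes "L2 M f" "L2 M g" shows "L2 M (\<lambda>x. f x - g x)"
  using L2_add[OF assms(1) L2_scale[OF assms(2), of "-1"]] by simp

lemma L2_lincomb:
  assumes "L2 M f" "L2 M g" shows "L2 M (\<lambda>x. a *\<^sub>R f x + b *\<^sub>R g x)"
  using assms by (intro L2_add L2_scale)

lemma ip_lincomb_right:
  assumes "L2 M f" "L2 M g" "L2 M h"
  shows "ip M h (\<lambda>x. a *\<^sub>R f x + b *\<^sub>R g x) = a * ip M h f + b * ip M h g"
  using L2_integrable_inner[OF assms(3,1)] L2_integrable_inner[OF assms(3,2)]
  by (simp add: ip_def inner_add_right)

lemma ip_diff_right:
  assumes "L2 M f" "L2 M g" "L2 M h"
  shows "ip M h (\<lambda>x. f x - g x) = ip M h f - ip M h g"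
  using ip_lincomb_right[OF assms, of 1 "-1"] by simp

lemma nsq_lincomb:
  assumes "L2 M f" "L2 M g"
  shows "nsq M (\<lambda>x. a *\<^sub>R f x + b *\<^sub>R g x) = a\<^sup>2 * nsq M f + 2 * a * b * ip M f g + b\<^sup>2 * nsq M g"
proof -
  have *: "ip M (\<lambda>x. a *\<^sub>R f x + b *\<^sub>R g x) k = a * ip M f k + b * ip M g k" if "L2 M k" for k
    using ip_lincomb_right[OF assms that] by (simp add: ip_commute)
  show ?thesis
    unfolding nsq_ip
    using assms L2_lincomb[OF assms, of a b]
    by (simp add: ip_lincomb_right * ip_commute[of M g f] power2_eq_square algebra_simps)
qed

text \<open>Parallelogram law with the square of f - g dropped.\<close>

lemma nsq_add_le:
  assumes "L2 M f" "L2 M g"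
  shows "nsq M (\<lambda>x. f x + g x) \<le> 2 * nsq M f + 2 * nsq M g"
  using nsq_lincomb[OF assms, of 1 1] nsq_lincomb[OF assms, of 1 "-1"]
    nsq_nonneg[of M "\<lambda>x. 1 *\<^sub>R f x + (-1) *\<^sub>R g x"] by simp

lemma nsq_diff_le:
  assumes "L2 M f" "L2 M g"
  shows "nsq M (\<lambda>x. f x - g x) \<le> 2 * nsq M f + 2 * nsq M g"
  using nsq_lincomb[OF assms, of 1 1] nsq_lincomb[OF assms, of 1 "-1"]
    nsq_nonneg[of M "\<lambda>x. 1 *\<^sub>R f x + 1 *\<^sub>R g x"] by simp

text \<open>The abstract core of Cauchy-Schwarz for semidefinite forms, used for \<open>ip\<close>
  and again for \<open>mu_form\<close>. The vertex t = -B / C gives the bound when C > 0.\<close>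

lemma discriminant_nonpos:
  fixes A B C :: real
  assumes "\<And>t. 0 \<le> A + 2 * t * B + t\<^sup>2 * C" "0 \<le> C"
  shows "B\<^sup>2 \<le> A * C"
proof (cases "C = 0")
  case True
  have "B = 0"
  proof (rule ccontr)
    assume "B \<noteq> 0"
    \<comment> \<open>At this t the linear polynomial A + 2 t B takes the value -1.\<close>
    then show False
      using assms(1)[of "- (A + 1) / (2 * B)"] True by (simp add: field_simps)
  qed
  then show ?thesis using True by simp
next
  case False
  then have C: "C > 0" using assms(2) by simp
  have "0 \<le> (A + 2 * (- B / C) * B + (- B / C)\<^sup>2 * C) * C"
    using assms(1)[of "- B / C"] C by simp
  also have "\<dots> = A * C - B\<^sup>2"
    using C by (simp add: field_simps power2_eq_square)
  finally show ?thesis by simp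
qed

lemma ip_Cauchy_Schwarz:
  assumes "L2 M f" "L2 M g"
  shows "(ip M f g)\<^sup>2 \<le> nsq M f * nsq M g"
proof (rule discriminant_nonpos)
  fix t
  show "0 \<le> nsq M f + 2 * t * ip M f g + t\<^sup>2 * nsq M g"
    using nsq_lincomb[OF assms, of 1 t] nsq_nonneg[of M "\<lambda>x. 1 *\<^sub>R f x + t *\<^sub>R g x"] by simp
qed simp

lemma tendsto_from_sq_bound:
  fixes a :: "nat \<Rightarrow> real"
  assumes "\<And>k. (a k - l)\<^sup>2 \<le> C * e k" "e \<longlonglongrightarrow> 0"
  shows "a \<longlonglongrightarrow> l"
proof -
  have "(\<lambda>k. (a k - l)\<^sup>2) \<longlonglongrightarrow> 0"
  proof (rule tendsto_sandwich[OF _ _ tendsto_const])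
    show "(\<lambda>k. C * e k) \<longlonglongrightarrow> 0"
      using tendsto_mult_right_zero[OF assms(2)] by simp
  qed (use assms(1) in auto)
  then have "(\<lambda>k. sqrt ((a k - l)\<^sup>2)) \<longlonglongrightarrow> sqrt 0"
    by (rule tendsto_real_sqrt)
  then show ?thesis
    by (simp add: LIM_zero_iff tendsto_rabs_zero_iff)
qed

lemma ip_tendsto:
  assumes "\<And>k. L2 M (f k)" "L2 M f'" "L2 M h" "(\<lambda>k. nsq M (\<lambda>x. f k x - f' x)) \<longlonglongrightarrow> 0"
  shows "(\<lambda>k. ip M h (f k)) \<longlonglongrightarrow> ip M h f'"
proof (rule tendsto_from_sq_bound[OF _ assms(4)])
  fix k
  show "(ip M h (f k) - ip M h f')\<^sup>2 \<le> nsq M h * nsq M (\<lambda>x. f k x - f' x)"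
    using ip_Cauchy_Schwarz[OF assms(3) L2_diff[OF assms(1)[of k] assms(2)]]
      ip_diff_right[OF assms(1)[of k] assms(2,3)] by simp
qed

text \<open>Expand f_k = (f_k - f') + f'; the cross term converges by
  \<open>ip_tendsto\<close>.\<close>

lemma nsq_tendsto:
  assumes "\<And>k. L2 M (f k)" "L2 M f'" "(\<lambda>k. nsq M (\<lambda>x. f k x - f' x)) \<longlonglongrightarrow> 0"
  shows "(\<lambda>k. nsq M (f k)) \<longlonglongrightarrow> nsq M f'"
proof -
  have eq: "nsq M (f k) = nsq M (\<lambda>x. f k x - f' x) + 2 * (ip M f' (f k) - ip M f' f') + nsq M f'" for k
    using nsq_lincomb[OF L2_diff[OF assms(1)[of k] assms(2)] assms(2), of 1 1]
      ip_diff_right[OF assms(1)[of k] assms(2,2)] by (simp add: ip_commute)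
  have "(\<lambda>k. nsq M (\<lambda>x. f k x - f' x) + 2 * (ip M f' (f k) - ip M f' f') + nsq M f')
      \<longlonglongrightarrow> 0 + 2 * (ip M f' f' - ip M f' f') + nsq M f'"
    by (intro tendsto_intros assms ip_tendsto)
  then show ?thesis
    unfolding eq by simp
qed

lemma L2_cong_AE:
  assumes "L2 M f" "g \<in> borel_measurable M" "AE x in M. f x = g x"
  shows "L2 M g"
proof -
  have "integrable M (\<lambda>x. (norm (g x))\<^sup>2)"
    by (rule integrable_cong_AE_imp[OF L2_integrable_sq[OF assms(1)]]) (use assms(2,3) in auto)
  then show ?thesis using assms(2) by (simp add: L2_def)
qed

lemma nsq_cong_AE:
  assumes "f \<in> borel_measurable M" "g \<in> borel_measurable M" "AE x in M. f x = g x"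
  shows "nsq M f = nsq M g"
  unfolding nsq_def using assms by (intro integral_cong_AE) auto

lemma nsq_eq_0_AE:
  assumes "L2 M f" "nsq M f = 0"
  shows "AE x in M. f x = 0"
  using assms integral_nonneg_eq_0_iff_AE[of M "\<lambda>x. (norm (f x))\<^sup>2"]
  by (auto simp: L2_def nsq_def)

lemma nn_integral_eq_nsq:
  assumes "L2 M f"
  shows "(\<integral>\<^sup>+x. ennreal ((norm (f x))\<^sup>2) \<partial>M) = ennreal (nsq M f)"
  using assms unfolding nsq_def L2_def by (intro nn_integral_eq_integral) auto

text \<open>Off S the difference f_k - f' is just -f', so the norm of f' off S is bounded by a null
  sequence.\<close>

lemma L2_limit_AE_zero_outside:
  assumes "\<And>k. L2 M (f k)" "L2 M f'" "(\<lambda>k. nsq M (\<lambda>x. f k x - f' x)) \<longlonglongrightarrow> 0"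
    and "S \<in> sets M" "\<And>k x. x \<notin> S \<Longrightarrow> f k x = 0"
  shows "AE x in M. x \<notin> S \<longrightarrow> f' x = 0"
proof -
  let ?h = "\<lambda>x. indicator (space M - S) x *\<^sub>R f' x"
  have h: "L2 M ?h"
  proof -
    have [measurable]: "f' \<in> borel_measurable M" using assms(2) by (rule L2_measurable)
    have "integrable M (\<lambda>x. (norm (?h x))\<^sup>2)"
      by (rule Bochner_Integration.integrable_bound[OF L2_integrable_sq[OF assms(2)]])
        (use assms(4) in \<open>auto simp: indicator_def\<close>)
    then show ?thesis
      using assms(4) by (auto simp: L2_def)
  qed
  have "nsq M ?h \<le> nsq M (\<lambda>x. f k x - f' x)" for k
    unfolding nsq_def using assms(5)
    by (intro integral_mono L2_integrable_sq h L2_diff assms(1,2)) (auto simp: indicator_def)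
  then have "nsq M ?h \<le> 0"
    by (intro tendsto_lowerbound[OF assms(3)]) auto
  then have "nsq M ?h = 0" by (simp add: antisym)
  from nsq_eq_0_AE[OF h this] AE_space show ?thesis
    by eventually_elim (auto simp: indicator_def split: if_splits)
qed

section \<open>Test functions and their \<open>H\<^sup>1\<close> limits\<close>


lemma partial_eqI:
  assumes "(f has_derivative D) (at x)"
  shows "partial b f x = D b"
proof -
  have lin: "linear D"
    using assms has_derivative_linear by blast
  have "((\<lambda>t::real. x + t *\<^sub>R b) has_derivative (\<lambda>t. t *\<^sub>R b)) (at 0)"
    by (auto intro!: derivative_eq_intros)
  moreover have "(f has_derivative D) (at (x + (0::real) *\<^sub>R b))"
    using assms by simp
  ultimately have "((\<lambda>t::real. f (x + t *\<^sub>R b)) has_derivative (\<lambda>t. D (t *\<^sub>R b))) (at 0)"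
    by (rule has_derivative_compose)
  then have "((\<lambda>t. f (x + t *\<^sub>R b)) has_field_derivative D b) (at 0)"
    by (simp add: has_field_derivative_def linear_cmul[OF lin] mult.commute[of _ "D b"])
  then show ?thesis
    unfolding partial_def by (rule DERIV_imp_deriv)
qed

text \<open>Links the coordinatewise \<open>cgrad\<close> to the Frechet derivative.\<close>

lemma cgrad_inner_eq:
  assumes "(f has_derivative D) (at x)"
  shows "cgrad f x \<bullet> h = D h"
proof -
  have lin: "linear D"
    using assms has_derivative_linear by blast
  have "D h = D (\<Sum>b\<in>Basis. (h \<bullet> b) *\<^sub>R b)"
    by (simp add: euclidean_representation)
  also have "\<dots> = (\<Sum>b\<in>Basis. (h \<bullet> b) * D b)"
    using lin by (simp add: linear_sum linear_cmul)
  also have "\<dots> = cgrad f x \<bullet> h"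
    by (simp add: cgrad_def partial_eqI[OF assms] inner_sum_left inner_commute[of h] mult.commute)
  finally show ?thesis by simp
qed

lemma smooth_fun_foldr:
  "smooth_fun f \<Longrightarrow> set bs \<subseteq> Basis \<Longrightarrow> foldr partial bs f differentiable (at x)"
  by (simp add: smooth_fun_def)

lemma smooth_fun_differentiable: "smooth_fun f \<Longrightarrow> f differentiable (at x)"
  using smooth_fun_foldr[of f "[]"] by simp

lemma smooth_fun_continuous: "smooth_fun f \<Longrightarrow> continuous_on A f"
  by (intro continuous_at_imp_continuous_on ballI differentiable_imp_continuous_within smooth_fun_differentiable)

lemma smooth_fun_continuous_partial:
  assumes "smooth_fun f" "b \<in> Basis" shows "continuous_on A (partial b f)"
  using smooth_fun_foldr[OF assms(1), of "[b]"] assms(2)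
  by (intro continuous_at_imp_continuous_on ballI differentiable_imp_continuous_within) simp

lemma smooth_fun_continuous_cgrad:
  assumes "smooth_fun f" shows "continuous_on A (cgrad f)"
  unfolding cgrad_def by (intro continuous_intros smooth_fun_continuous_partial assms)

lemma smooth_fun_has_derivative:
  assumes "smooth_fun f" shows "(f has_derivative (\<lambda>h. cgrad f x \<bullet> h)) (at x)"
proof -
  obtain D where "(f has_derivative D) (at x)"
    using smooth_fun_differentiable[OF assms] by (auto simp: differentiable_def)
  with cgrad_inner_eq[OF this] show ?thesis by simp
qed

lemma partial_lincomb:
  assumes "f differentiable (at x)" "g differentiable (at x)"
  shows "partial b (\<lambda>x. \<alpha> * f x + \<beta> * g x) x = \<alpha> * partial b f x + \<beta> * partial b g x"
proof -
  obtain D E where D: "(f has_derivative D) (at x)" and E: "(g has_derivative E) (at x)"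
    using assms by (auto simp: differentiable_def)
  have "((\<lambda>x. \<alpha> * f x + \<beta> * g x) has_derivative (\<lambda>h. \<alpha> * D h + \<beta> * E h)) (at x)"
    using D E by (auto intro!: derivative_eq_intros)
  from partial_eqI[OF this] partial_eqI[OF D] partial_eqI[OF E] show ?thesis
    by simp
qed

lemma smooth_fun_lincomb:
  assumes "smooth_fun f" "smooth_fun g"
  shows "smooth_fun (\<lambda>x. \<alpha> * f x + \<beta> * g x)"
proof -
  have *: "foldr partial bs (\<lambda>x. \<alpha> * f x + \<beta> * g x) = (\<lambda>x. \<alpha> * foldr partial bs f x + \<beta> * foldr partial bs g x)"
    if "set bs \<subseteq> Basis" for bs
    using that
  proof (induction bs)
    case (Cons b bs)
    then have "foldr partial bs (\<lambda>x. \<alpha> * f x + \<beta> * g x) = (\<lambda>x. \<alpha> * foldr partial bs f x + \<beta> * foldr partial bs g x)"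
      by simp
    then show ?case
      using smooth_fun_foldr[OF assms(1), of bs] smooth_fun_foldr[OF assms(2), of bs] Cons.prems
      by (simp only: foldr.simps o_apply) (auto simp: partial_lincomb)
  qed simp
  show ?thesis
    unfolding smooth_fun_def
  proof (intro allI impI)
    fix bs :: "'a list" and x
    assume bs: "set bs \<subseteq> Basis"
    show "foldr partial bs (\<lambda>x. \<alpha> * f x + \<beta> * g x) differentiable at x"
      unfolding *[OF bs]
      using smooth_fun_foldr[OF assms(1) bs, of x] smooth_fun_foldr[OF assms(2) bs, of x]
      by (intro differentiable_add differentiable_mult) auto
  qed
qed

lemma cgrad_lincomb:
  assumes "smooth_fun f" "smooth_fun g"
  shows "cgrad (\<lambda>x. \<alpha> * f x + \<beta> * g x) x = \<alpha> *\<^sub>R cgrad f x + \<beta> *\<^sub>R cgrad g x"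
  by (simp add: cgrad_def partial_lincomb smooth_fun_differentiable assms scaleR_sum_right
      scaleR_add_left sum.distrib)

lemma test_fun_smooth: "test_fun U f \<Longrightarrow> smooth_fun f"
  by (simp add: test_fun_def)

lemma test_fun_mono: "test_fun U f \<Longrightarrow> U \<subseteq> V \<Longrightarrow> test_fun V f"
  by (auto simp: test_fun_def)

lemma test_fun_zero_outside:
  assumes "test_fun U f" "x \<notin> U" shows "f x = 0"
  using assms closure_subset[of "{x. f x \<noteq> 0}"] by (auto simp: test_fun_def)

lemma test_fun_lincomb:
  assumes "test_fun U f" "test_fun U g"
  shows "test_fun U (\<lambda>x. \<alpha> * f x + \<beta> * g x)"
proof -
  define S where "S = closure {x. f x \<noteq> 0} \<union> closure {x. g x \<noteq> 0}"
  have "{x. \<alpha> * f x + \<beta> * g x \<noteq> 0} \<subseteq> {x. f x \<noteq> 0} \<union> {x. g x \<noteq> 0}"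
    by auto
  then have sub: "closure {x. \<alpha> * f x + \<beta> * g x \<noteq> 0} \<subseteq> S"
    unfolding S_def closure_Un[symmetric] by (rule closure_mono)
  have "compact S"
    using assms by (auto simp: test_fun_def S_def)
  then have "compact (closure {x. \<alpha> * f x + \<beta> * g x \<noteq> 0})"
    using compact_Int_closed[of S "closure {x. \<alpha> * f x + \<beta> * g x \<noteq> 0}"] sub
    by (simp add: Int_absorb1)
  then show ?thesis
    using sub assms by (auto simp: test_fun_def S_def intro: smooth_fun_lincomb)
qed

lemma cgrad_zero_outside_support:
  assumes "x \<notin> closure {x. f x \<noteq> 0}"
  shows "cgrad f x = 0"
proof -
  have "((\<lambda>x. 0) has_derivative (\<lambda>h. 0)) (at x)"
    by simp
  then have "(f has_derivative (\<lambda>h. 0)) (at x)"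
    by (rule has_derivative_transform_within_open[where s="- closure {x. f x \<noteq> 0}"])
      (use assms closure_subset[of "{x. f x \<noteq> 0}"] in auto)
  from cgrad_inner_eq[OF this, of "cgrad f x"] show ?thesis
    by simp
qed

lemma test_fun_cgrad_zero_outside:
  assumes "test_fun U f" "x \<notin> U" shows "cgrad f x = 0"
  using assms by (intro cgrad_zero_outside_support) (auto simp: test_fun_def)

section \<open>Test functions and their gradients in L^2, and their H^1 limits\<close>

lemma L2_continuous_compact_support:
  fixes f :: "'a::euclidean_space \<Rightarrow> 'b::euclidean_space"
  assumes "continuous_on UNIV f" "compact K" "\<And>x. x \<notin> K \<Longrightarrow> f x = 0"
  shows "L2 lborel f"
proof -
  have m: "f \<in> borel_measurable borel"
    using assms(1) by (rule borel_measurable_continuous_onI)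
  have "integrable lborel (\<lambda>x. indicator K x *\<^sub>R (norm (f x))\<^sup>2)"
    by (rule borel_integrable_compact[OF assms(2)])
      (intro continuous_intros continuous_on_subset[OF assms(1)] subset_UNIV)
  moreover have "(\<lambda>x. indicator K x *\<^sub>R (norm (f x))\<^sup>2) = (\<lambda>x. (norm (f x))\<^sup>2)"
    using assms(3) by (auto simp: indicator_def fun_eq_iff)
  ultimately show ?thesis
    using m by (simp add: L2_def)
qed

lemma L2_lebesgue: "L2 lborel f \<Longrightarrow> L2 lebesgue f"
  by (auto simp: L2_def integrable_completion measurable_completion)

lemma nsq_lebesgue: "f \<in> borel_measurable borel \<Longrightarrow> nsq lebesgue f = nsq lborel f"
  unfolding nsq_def by (rule integral_completion) simp

lemma test_fun_L2: "test_fun U f \<Longrightarrow> L2 lborel f"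
  using closure_subset[of "{x. f x \<noteq> 0}"]
  by (auto simp: test_fun_def intro!: L2_continuous_compact_support[of f "closure {x. f x \<noteq> 0}"]
      smooth_fun_continuous)

lemma test_fun_L2_cgrad: "test_fun U f \<Longrightarrow> L2 lborel (cgrad f)"
  by (auto simp: test_fun_def intro!: L2_continuous_compact_support[of "cgrad f" "closure {x. f x \<noteq> 0}"]
      smooth_fun_continuous_cgrad cgrad_zero_outside_support)

text \<open>Carries the gradient as an explicit second argument, so neither choice nor
  \<open>weak_grad\<close> enters. A test function qualifies with \<open>cgrad\<close> directly,
  without integration by parts, and differences between a function and its approximants stay in the
  class.\<close>

definition H1_limit :: "'a::euclidean_space set \<Rightarrow> ('a \<Rightarrow> real) \<Rightarrow> ('a \<Rightarrow> 'a) \<Rightarrow> bool" where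
  "H1_limit U u g \<longleftrightarrow> L2 lebesgue u \<and> L2 lebesgue g \<and>
     (\<exists>\<phi>::nat \<Rightarrow> 'a \<Rightarrow> real. (\<forall>k. test_fun U (\<phi> k)) \<and>
        (\<lambda>k. nsq lebesgue (\<lambda>x. \<phi> k x - u x)) \<longlonglongrightarrow> 0 \<and>
        (\<lambda>k. nsq lebesgue (\<lambda>x. cgrad (\<phi> k) x - g x)) \<longlonglongrightarrow> 0)"

lemma H10_iff: "u \<in> H10 U \<longleftrightarrow> (\<exists>g. weak_grad u g \<and> H1_limit U u g)"
  unfolding H10_def H1_limit_def
  by (auto simp: L2_def nsq_def weak_grad_def)

lemma H1_limit_test_fun: "test_fun U f \<Longrightarrow> H1_limit U f (cgrad f)"
  unfolding H1_limit_def
  by (auto simp: nsq_def intro: L2_lebesgue test_fun_L2 test_fun_L2_cgrad intro!: exI[of _ "\<lambda>_. f"])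

lemma H1_limit_mono: "H1_limit U u g \<Longrightarrow> U \<subseteq> V \<Longrightarrow> H1_limit V u g"
  unfolding H1_limit_def by (meson test_fun_mono)

lemma H1_limit_L2: "H1_limit U u g \<Longrightarrow> L2 lebesgue u"
  and H1_limit_L2_grad: "H1_limit U u g \<Longrightarrow> L2 lebesgue g"
  by (auto simp: H1_limit_def)

lemma H1_limitE:
  assumes "H1_limit U u g"
  obtains \<phi> :: "nat \<Rightarrow> 'a::euclidean_space \<Rightarrow> real" where "\<And>k. test_fun U (\<phi> k)"
    "(\<lambda>k. nsq lebesgue (\<lambda>x. \<phi> k x - u x)) \<longlonglongrightarrow> 0"
    "(\<lambda>k. nsq lebesgue (\<lambda>x. cgrad (\<phi> k) x - g x)) \<longlonglongrightarrow> 0"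
  using assms unfolding H1_limit_def by blast

lemma H1_limit_lincomb:
  fixes u v :: "'a::euclidean_space \<Rightarrow> real"
  assumes "H1_limit U u g" "H1_limit U v h"
  shows "H1_limit U (\<lambda>x. a * u x + b * v x) (\<lambda>x. a *\<^sub>R g x + b *\<^sub>R h x)"
proof -
  obtain \<phi> where \<phi>: "\<And>k. test_fun U (\<phi> k)"
    "(\<lambda>k. nsq lebesgue (\<lambda>x. \<phi> k x - u x)) \<longlonglongrightarrow> 0"
    "(\<lambda>k. nsq lebesgue (\<lambda>x. cgrad (\<phi> k) x - g x)) \<longlonglongrightarrow> 0"
    using H1_limitE[OF assms(1)] by blast
  obtain \<psi> where \<psi>: "\<And>k. test_fun U (\<psi> k)"
    "(\<lambda>k. nsq lebesgue (\<lambda>x. \<psi> k x - v x)) \<longlonglongrightarrow> 0"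
    "(\<lambda>k. nsq lebesgue (\<lambda>x. cgrad (\<psi> k) x - h x)) \<longlonglongrightarrow> 0"
    using H1_limitE[OF assms(2)] by blast
  \<comment> \<open>Left generic in the codomain: it is applied once to the functions and once to
    their gradients.\<close>
  have aux: "(\<lambda>k. nsq lebesgue (\<lambda>x. (a *\<^sub>R f k x + b *\<^sub>R q k x) - (a *\<^sub>R f' x + b *\<^sub>R q' x))) \<longlonglongrightarrow> 0"
    if "\<And>k. L2 lebesgue (f k)" "\<And>k. L2 lebesgue (q k)" "L2 lebesgue f'" "L2 lebesgue q'"
      "(\<lambda>k. nsq lebesgue (\<lambda>x. f k x - f' x)) \<longlonglongrightarrow> 0"
      "(\<lambda>k. nsq lebesgue (\<lambda>x. q k x - q' x)) \<longlonglongrightarrow> 0"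
    for f q :: "nat \<Rightarrow> 'a \<Rightarrow> 'b::euclidean_space" and f' q'
  proof (rule tendsto_sandwich[OF _ _ tendsto_const])
    show "(\<lambda>k. 2 * (a\<^sup>2 * nsq lebesgue (\<lambda>x. f k x - f' x)) + 2 * (b\<^sup>2 * nsq lebesgue (\<lambda>x. q k x - q' x))) \<longlonglongrightarrow> 0"
      using that(5,6) by (auto intro!: tendsto_eq_intros)
    have "nsq lebesgue (\<lambda>x. (a *\<^sub>R f k x + b *\<^sub>R q k x) - (a *\<^sub>R f' x + b *\<^sub>R q' x))
        \<le> 2 * (a\<^sup>2 * nsq lebesgue (\<lambda>x. f k x - f' x)) + 2 * (b\<^sup>2 * nsq lebesgue (\<lambda>x. q k x - q' x))" for k
    proof -
      have "nsq lebesgue (\<lambda>x. a *\<^sub>R (f k x - f' x) + b *\<^sub>R (q k x - q' x))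
        \<le> 2 * nsq lebesgue (\<lambda>x. a *\<^sub>R (f k x - f' x)) + 2 * nsq lebesgue (\<lambda>x. b *\<^sub>R (q k x - q' x))"
        using that by (intro nsq_add_le L2_scale L2_diff)
      then show ?thesis
        unfolding nsq_scale by (simp add: scaleR_diff_right algebra_simps)
    qed
    then show "\<forall>\<^sub>F k in sequentially. nsq lebesgue (\<lambda>x. (a *\<^sub>R f k x + b *\<^sub>R q k x) - (a *\<^sub>R f' x + b *\<^sub>R q' x))
        \<le> 2 * (a\<^sup>2 * nsq lebesgue (\<lambda>x. f k x - f' x)) + 2 * (b\<^sup>2 * nsq lebesgue (\<lambda>x. q k x - q' x))"
      by simp
  qed auto
  show ?thesis
    unfolding H1_limit_def
  proof (intro conjI exI allI)
    show "L2 lebesgue (\<lambda>x. a * u x + b * v x)"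
      using L2_lincomb[of lebesgue u v a b] assms by (auto dest: H1_limit_L2)
    show "L2 lebesgue (\<lambda>x. a *\<^sub>R g x + b *\<^sub>R h x)"
      using assms by (auto intro: L2_lincomb dest: H1_limit_L2_grad)
    show "test_fun U (\<lambda>x. a * \<phi> k x + b * \<psi> k x)" for k
      using \<phi>(1) \<psi>(1) by (rule test_fun_lincomb)
    show "(\<lambda>k. nsq lebesgue (\<lambda>x. (a * \<phi> k x + b * \<psi> k x) - (a * u x + b * v x))) \<longlonglongrightarrow> 0"
      using aux[of \<phi> \<psi> u v] \<phi> \<psi> assms by (auto intro: L2_lebesgue test_fun_L2 dest: H1_limit_L2)
    show "(\<lambda>k. nsq lebesgue (\<lambda>x. cgrad (\<lambda>x. a * \<phi> k x + b * \<psi> k x) x - (a *\<^sub>R g x + b *\<^sub>R h x))) \<longlonglongrightarrow> 0"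
    proof -
      have "cgrad (\<lambda>x. a * \<phi> k x + b * \<psi> k x) x = a *\<^sub>R cgrad (\<phi> k) x + b *\<^sub>R cgrad (\<psi> k) x" for k x
        using \<phi>(1) \<psi>(1) by (intro cgrad_lincomb test_fun_smooth)
      then show ?thesis
        using aux[of "\<lambda>k. cgrad (\<phi> k)" "\<lambda>k. cgrad (\<psi> k)" g h] \<phi> \<psi>
          H1_limit_L2_grad[OF assms(1)] H1_limit_L2_grad[OF assms(2)]
        by (simp add: L2_lebesgue test_fun_L2_cgrad[of U])
    qed
  qed
qed

lemma H1_limit_zero_outside:
  assumes "H1_limit U u g" "U \<in> sets lebesgue"
  shows "AE x in lebesgue. x \<notin> U \<longrightarrow> u x = 0"
    and "AE x in lebesgue. x \<notin> U \<longrightarrow> g x = 0"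
proof -
  obtain \<phi> where \<phi>: "\<And>k. test_fun U (\<phi> k)"
    "(\<lambda>k. nsq lebesgue (\<lambda>x. \<phi> k x - u x)) \<longlonglongrightarrow> 0"
    "(\<lambda>k. nsq lebesgue (\<lambda>x. cgrad (\<phi> k) x - g x)) \<longlonglongrightarrow> 0"
    using H1_limitE[OF assms(1)] by blast
  show "AE x in lebesgue. x \<notin> U \<longrightarrow> u x = 0"
    by (rule L2_limit_AE_zero_outside[OF _ H1_limit_L2[OF assms(1)] \<phi>(2) assms(2)])
      (use \<phi>(1) in \<open>auto intro: L2_lebesgue test_fun_L2 test_fun_zero_outside\<close>)
  show "AE x in lebesgue. x \<notin> U \<longrightarrow> g x = 0"
    by (rule L2_limit_AE_zero_outside[OF _ H1_limit_L2_grad[OF assms(1)] \<phi>(3) assms(2)])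
      (use \<phi>(1) in \<open>auto intro: L2_lebesgue test_fun_L2_cgrad test_fun_cgrad_zero_outside\<close>)
qed

section \<open>The translation estimate\<close>


lemma borel_translate: "f \<in> borel_measurable borel \<Longrightarrow> (\<lambda>x. f (x + z)) \<in> borel_measurable borel"
  for z :: "'a::euclidean_space"
  by (rule measurable_compose[of "\<lambda>x. x + z" borel borel f]) auto

lemma nn_integral_translate:
  fixes f :: "'a::euclidean_space \<Rightarrow> ennreal"
  assumes "f \<in> borel_measurable borel"
  shows "(\<integral>\<^sup>+x. f (x + z) \<partial>lborel) = (\<integral>\<^sup>+x. f x \<partial>lborel)"
proof -
  have "(\<integral>\<^sup>+x. f x \<partial>lborel) = (\<integral>\<^sup>+x. f x \<partial>distr lborel borel ((+) z))"
    by (simp add: lborel_distr_plus)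
  also have "\<dots> = (\<integral>\<^sup>+x. f (z + x) \<partial>lborel)"
    using assms by (intro nn_integral_distr) auto
  finally show ?thesis by (simp add: add.commute)
qed

lemma L2_translate:
  fixes f :: "'a::euclidean_space \<Rightarrow> 'b::euclidean_space"
  assumes "L2 lborel f" shows "L2 lborel (\<lambda>x. f (x + z))"
    and "nsq lborel (\<lambda>x. f (x + z)) = nsq lborel f"
proof -
  have m: "f \<in> borel_measurable borel" using L2_measurable[OF assms] by simp
  have "integrable (distr lborel borel ((+) z)) (\<lambda>x. (norm (f x))\<^sup>2)"
    using L2_integrable_sq[OF assms] by (simp add: lborel_distr_plus)
  then have "integrable lborel (\<lambda>x. (norm (f (z + x)))\<^sup>2)"
    using m by (subst (asm) integrable_distr_eq) auto
  then show "L2 lborel (\<lambda>x. f (x + z))"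
    using borel_translate[OF m, of z] by (simp add: L2_def add.commute)
  have "nsq lborel f = (\<integral>x. (norm (f x))\<^sup>2 \<partial>distr lborel borel ((+) z))"
    by (simp add: lborel_distr_plus nsq_def)
  also have "\<dots> = (\<integral>x. (norm (f (z + x)))\<^sup>2 \<partial>lborel)"
    using m by (intro integral_distr) auto
  finally show "nsq lborel (\<lambda>x. f (x + z)) = nsq lborel f"
    by (simp add: nsq_def add.commute)
qed

lemma indicator_power: "0 < n \<Longrightarrow> (indicator A x :: 'a::comm_semiring_1) ^ n = indicator A x"
  by (simp add: indicator_def power_0_left)

text \<open>Cauchy-Schwarz for f against the indicator of [0,1], which has norm 1.\<close>

lemma FTC_square_bound:
  fixes F f :: "real \<Rightarrow> real"
  assumes "\<And>t. (F has_field_derivative f t) (at t)" "continuous_on UNIV f"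
  shows "(F 1 - F 0)\<^sup>2 \<le> (LINT t|lborel. indicator {0..1} t * (f t)\<^sup>2)"
proof -
  let ?I = "indicator {0..1::real} :: real \<Rightarrow> real"
  have cont: "continuous_on A f" for A
    using assms(2) continuous_on_subset by blast
  have meas: "f \<in> borel_measurable borel"
    using assms(2) by (rule borel_measurable_continuous_onI)
  have eq: "(LINT t|lborel. ?I t *\<^sub>R f t) = F 1 - F 0"
    by (rule integral_FTC_Icc) (use assms(1) cont in
        \<open>auto simp flip: has_real_derivative_iff_has_vector_derivative intro: has_field_derivative_at_within\<close>)
  have "integrable lborel (\<lambda>t. ?I t *\<^sub>R (f t)\<^sup>2)"
    by (intro borel_integrable_compact continuous_intros cont) simp
  then have "L2 lborel (\<lambda>t. ?I t * f t)"
    using meas by (auto simp: L2_def power_mult_distrib indicator_power)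
  moreover have "L2 lborel ?I"
    by (auto simp: L2_def power2_eq_square indicator_inter_arith[symmetric])
  ultimately have "(ip lborel ?I (\<lambda>t. ?I t * f t))\<^sup>2 \<le> nsq lborel ?I * nsq lborel (\<lambda>t. ?I t * f t)"
    by (intro ip_Cauchy_Schwarz)
  moreover have "ip lborel ?I (\<lambda>t. ?I t * f t) = F 1 - F 0"
    unfolding ip_def eq[symmetric] by (intro Bochner_Integration.integral_cong) (auto simp: indicator_def)
  moreover have "nsq lborel ?I = 1"
    by (simp add: nsq_def power2_eq_square indicator_inter_arith[symmetric])
  moreover have "nsq lborel (\<lambda>t. ?I t * f t) = (LINT t|lborel. ?I t * (f t)\<^sup>2)"
    unfolding nsq_def by (intro Bochner_Integration.integral_cong) (auto simp: indicator_def)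
  ultimately show ?thesis by simp
qed

text \<open>Write f(x + z) - f(x) as the integral of the derivative along the segment from x to x +
  z, square it by \<open>FTC_square_bound\<close> and integrate over x. After exchanging the
  integrals, translation invariance makes the inner one independent of t.\<close>

lemma test_fun_translation_bound:
  fixes z :: "'a::euclidean_space"
  assumes "test_fun U f"
  shows "nsq lborel (\<lambda>x. f (x + z) - f x) \<le> (norm z)\<^sup>2 * nsq lborel (cgrad f)"
proof -
  let ?g = "\<lambda>x. (norm (cgrad f x))\<^sup>2"
  have sm: "smooth_fun f" using assms by (rule test_fun_smooth)
  have [measurable]: "cgrad f \<in> borel_measurable borel"
    by (intro borel_measurable_continuous_onI smooth_fun_continuous_cgrad sm)
  have pt: "ennreal ((f (x + z) - f x)\<^sup>2)
      \<le> (\<integral>\<^sup>+t. ennreal ((norm z)\<^sup>2) * (indicator {0..1} t * ennreal (?g (x + t *\<^sub>R z))) \<partial>lborel)" for x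
  proof -
    let ?F = "\<lambda>t. f (x + t *\<^sub>R z)" and ?f = "\<lambda>t. cgrad f (x + t *\<^sub>R z) \<bullet> z"
    have cg: "continuous_on UNIV (\<lambda>t. cgrad f (x + t *\<^sub>R z))"
      by (rule continuous_on_compose2[OF smooth_fun_continuous_cgrad[OF sm, of UNIV]]) (auto intro!: continuous_intros)
    have "(?F has_field_derivative ?f t) (at t)" for t
    proof -
      have "((\<lambda>t. x + t *\<^sub>R z) has_derivative (\<lambda>h. h *\<^sub>R z)) (at t)"
        by (auto intro!: derivative_eq_intros)
      from has_derivative_compose[OF this smooth_fun_has_derivative[OF sm]]
      show ?thesis
        by (simp add: has_field_derivative_def mult_commute_abs)
    qed
    then have "(?F 1 - ?F 0)\<^sup>2 \<le> (LINT t|lborel. indicator {0..1} t * (?f t)\<^sup>2)"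
      by (rule FTC_square_bound) (intro continuous_intros cg)
    also have "\<dots> \<le> (LINT t|lborel. indicator {0..1} t *\<^sub>R ((norm z)\<^sup>2 * ?g (x + t *\<^sub>R z)))"
    proof (rule integral_mono)
      have "integrable lborel (\<lambda>t. indicator {0..1} t *\<^sub>R (?f t)\<^sup>2)"
        by (intro borel_integrable_compact continuous_intros continuous_on_subset[OF cg]) auto
      then show "integrable lborel (\<lambda>t. indicator {0..1} t * (?f t)\<^sup>2)" by simp
      show "integrable lborel (\<lambda>t. indicator {0..1} t *\<^sub>R ((norm z)\<^sup>2 * ?g (x + t *\<^sub>R z)))"
        by (intro borel_integrable_compact continuous_intros continuous_on_subset[OF cg]) auto
      show "indicator {0..1} t * (?f t)\<^sup>2 \<le> indicator {0..1} t *\<^sub>R ((norm z)\<^sup>2 * ?g (x + t *\<^sub>R z))" for t :: real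
        using Cauchy_Schwarz_ineq[of "cgrad f (x + t *\<^sub>R z)" z]
        by (auto simp: indicator_def power2_norm_eq_inner mult.commute)
    qed
    finally have le: "(f (x + z) - f x)\<^sup>2 \<le> (LINT t|lborel. indicator {0..1} t *\<^sub>R ((norm z)\<^sup>2 * ?g (x + t *\<^sub>R z)))"
      by simp
    have "ennreal (LINT t|lborel. indicator {0..1} t *\<^sub>R ((norm z)\<^sup>2 * ?g (x + t *\<^sub>R z)))
       = (\<integral>\<^sup>+t. ennreal (indicator {0..1} t *\<^sub>R ((norm z)\<^sup>2 * ?g (x + t *\<^sub>R z))) \<partial>lborel)"
      by (rule nn_integral_eq_integral[symmetric])
        (intro borel_integrable_compact continuous_intros continuous_on_subset[OF cg], auto)
    also have "\<dots> = (\<integral>\<^sup>+t. ennreal ((norm z)\<^sup>2) * (indicator {0..1} t * ennreal (?g (x + t *\<^sub>R z))) \<partial>lborel)"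
      by (intro nn_integral_cong) (auto simp: indicator_def ennreal_mult)
    finally show ?thesis
      using ennreal_leI[OF le] by (simp only:)
  qed
  have L: "L2 lborel (\<lambda>x. f (x + z) - f x)"
    using test_fun_L2[OF assms] by (intro L2_diff L2_translate)
  have "ennreal (nsq lborel (\<lambda>x. f (x + z) - f x)) = (\<integral>\<^sup>+x. ennreal ((f (x + z) - f x)\<^sup>2) \<partial>lborel)"
    using nn_integral_eq_nsq[OF L] by simp
  also have "\<dots> \<le> (\<integral>\<^sup>+x. \<integral>\<^sup>+t. ennreal ((norm z)\<^sup>2) * (indicator {0..1} t * ennreal (?g (x + t *\<^sub>R z))) \<partial>lborel \<partial>lborel)"
    by (intro nn_integral_mono pt)
  also have "\<dots> = (\<integral>\<^sup>+t. \<integral>\<^sup>+x. ennreal ((norm z)\<^sup>2) * (indicator {0..1} t * ennreal (?g (x + t *\<^sub>R z))) \<partial>lborel \<partial>lborel)"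
    by (rule lborel_pair.Fubini'[symmetric]) measurable
  also have "\<dots> = (\<integral>\<^sup>+t. ennreal ((norm z)\<^sup>2) * (indicator {0..1::real} t * ennreal (nsq lborel (cgrad f))) \<partial>lborel)"
  proof (intro nn_integral_cong)
    fix t :: real
    have "(\<integral>\<^sup>+x. ennreal (?g (x + t *\<^sub>R z)) \<partial>lborel) = ennreal (nsq lborel (cgrad f))"
      using nn_integral_eq_nsq[OF L2_translate(1)[OF test_fun_L2_cgrad[OF assms]]]
      by (simp add: L2_translate(2)[OF test_fun_L2_cgrad[OF assms]])
    then show "(\<integral>\<^sup>+x. ennreal ((norm z)\<^sup>2) * (indicator {0..1} t * ennreal (?g (x + t *\<^sub>R z))) \<partial>lborel)
       = ennreal ((norm z)\<^sup>2) * (indicator {0..1::real} t * ennreal (nsq lborel (cgrad f)))"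
      by (simp add: nn_integral_cmult)
  qed
  also have "\<dots> = ennreal ((norm z)\<^sup>2 * nsq lborel (cgrad f))"
    by (simp add: nn_integral_cmult nn_integral_multc ennreal_mult)
  finally show ?thesis
    by (simp add: ennreal_le_iff)
qed

text \<open>The Borel representative \<open>u'\<close> is needed because \<open>lebesgue \<Otimes>\<^sub>M lebesgue\<close> is not complete: for a merely
  Lebesgue measurable \<open>u\<close>, the map \<open>(x, z) \<mapsto> u (x + z)\<close> need not be measurable there.\<close>
lemma H1_limit_translation_bound:
  fixes u :: "'a::euclidean_space \<Rightarrow> real"
  assumes "H1_limit U u g"
  obtains u' where "u' \<in> borel_measurable borel" "AE x in lborel. u x = u' x" "L2 lborel u'"
    "nsq lborel u' = nsq lebesgue u"
    "\<And>z. nsq lborel (\<lambda>x. u' (x + z) - u' x) \<le> (norm z)\<^sup>2 * nsq lebesgue g"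
proof -
  obtain u' where m: "u' \<in> borel_measurable borel" and ae: "AE x in lborel. u x = u' x"
    using completion_ex_borel_measurable_real[OF L2_measurable[OF H1_limit_L2[OF assms]]] by auto
  have ae': "AE x in lebesgue. u x = u' x"
    using ae by (rule AE_completion)
  have m': "u' \<in> borel_measurable lebesgue" using m by (simp add: measurable_completion)
  have L': "L2 lebesgue u'"
    by (rule L2_cong_AE[OF H1_limit_L2[OF assms] m' ae'])
  then have L: "L2 lborel u'"
    using m by (auto simp: L2_def integrable_completion)
  have nsq': "nsq lborel u' = nsq lebesgue u"
    using nsq_cong_AE[OF L2_measurable[OF H1_limit_L2[OF assms]] m' ae'] nsq_lebesgue[OF m] by simp
  obtain \<phi> where \<phi>: "\<And>k. test_fun U (\<phi> k)"
    "(\<lambda>k. nsq lebesgue (\<lambda>x. \<phi> k x - u x)) \<longlonglongrightarrow> 0"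
    "(\<lambda>k. nsq lebesgue (\<lambda>x. cgrad (\<phi> k) x - g x)) \<longlonglongrightarrow> 0"
    using H1_limitE[OF assms] by blast
  have L\<phi>: "L2 lborel (\<phi> k)" for k using \<phi>(1) by (rule test_fun_L2)
  have "nsq lebesgue (\<lambda>x. \<phi> k x - u x) = nsq lborel (\<lambda>x. \<phi> k x - u' x)" for k
  proof -
    have "nsq lebesgue (\<lambda>x. \<phi> k x - u x) = nsq lebesgue (\<lambda>x. \<phi> k x - u' x)"
      using ae' L2_measurable[OF L2_diff[OF L2_lebesgue[OF L\<phi>[of k]] H1_limit_L2[OF assms]]]
        L2_measurable[OF L2_diff[OF L2_lebesgue[OF L\<phi>[of k]] L']]
      by (intro nsq_cong_AE) auto
    also have "\<dots> = nsq lborel (\<lambda>x. \<phi> k x - u' x)"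
      using L2_measurable[OF L2_diff[OF L\<phi>[of k] L]] by (intro nsq_lebesgue) simp
    finally show ?thesis .
  qed
  with \<phi>(2) have lim: "(\<lambda>k. nsq lborel (\<lambda>x. \<phi> k x - u' x)) \<longlonglongrightarrow> 0" by simp
  \<comment> \<open>Both sides of the estimate for the approximating test functions converge, so the
    inequality passes to the limit.\<close>
  have "nsq lborel (\<lambda>x. u' (x + z) - u' x) \<le> (norm z)\<^sup>2 * nsq lebesgue g" for z
  proof (rule LIMSEQ_le)
    show "(\<lambda>k. nsq lborel (\<lambda>x. \<phi> k (x + z) - \<phi> k x)) \<longlonglongrightarrow> nsq lborel (\<lambda>x. u' (x + z) - u' x)"
    proof (rule nsq_tendsto)
      show "L2 lborel (\<lambda>x. \<phi> k (x + z) - \<phi> k x)" for k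
        by (intro L2_diff L2_translate L\<phi>)
      show "L2 lborel (\<lambda>x. u' (x + z) - u' x)"
        by (intro L2_diff L2_translate L)
      show "(\<lambda>k. nsq lborel (\<lambda>x. (\<phi> k (x + z) - \<phi> k x) - (u' (x + z) - u' x))) \<longlonglongrightarrow> 0"
      proof (rule tendsto_sandwich[OF _ _ tendsto_const])
        show "(\<lambda>k. 4 * nsq lborel (\<lambda>x. \<phi> k x - u' x)) \<longlonglongrightarrow> 0"
          using tendsto_mult_right_zero[OF lim] by simp
        \<comment> \<open>The constant is 2 + 2, as translation preserves
          \<open>nsq\<close>.\<close>
        have "nsq lborel (\<lambda>x. (\<phi> k (x + z) - \<phi> k x) - (u' (x + z) - u' x)) \<le> 4 * nsq lborel (\<lambda>x. \<phi> k x - u' x)" for k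
        proof -
          have *: "L2 lborel (\<lambda>x. \<phi> k x - u' x)" by (intro L2_diff L\<phi> L)
          have "nsq lborel (\<lambda>x. (\<phi> k (x + z) - u' (x + z)) - (\<phi> k x - u' x)) \<le>
            2 * nsq lborel (\<lambda>x. \<phi> k (x + z) - u' (x + z)) + 2 * nsq lborel (\<lambda>x. \<phi> k x - u' x)"
            by (rule nsq_diff_le[OF L2_translate(1)[OF *] *])
          then show ?thesis
            by (simp add: L2_translate(2)[OF *] algebra_simps)
        qed
        then show "\<forall>\<^sub>F k in sequentially. nsq lborel (\<lambda>x. (\<phi> k (x + z) - \<phi> k x) - (u' (x + z) - u' x))
            \<le> 4 * nsq lborel (\<lambda>x. \<phi> k x - u' x)" by simp
      qed auto
    qed
    have "(\<lambda>k. nsq lebesgue (cgrad (\<phi> k))) \<longlonglongrightarrow> nsq lebesgue g"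
      by (rule nsq_tendsto[OF _ H1_limit_L2_grad[OF assms] \<phi>(3)])
        (intro L2_lebesgue test_fun_L2_cgrad[OF \<phi>(1)])
    then show "(\<lambda>k. (norm z)\<^sup>2 * nsq lebesgue (cgrad (\<phi> k))) \<longlonglongrightarrow> (norm z)\<^sup>2 * nsq lebesgue g"
      by (intro tendsto_intros)
    have "nsq lborel (\<lambda>x. \<phi> k (x + z) - \<phi> k x) \<le> (norm z)\<^sup>2 * nsq lebesgue (cgrad (\<phi> k))" for k
      using test_fun_translation_bound[OF \<phi>(1)[of k], of z]
        nsq_lebesgue[of "cgrad (\<phi> k)"] L2_measurable[OF test_fun_L2_cgrad[OF \<phi>(1)[of k]]] by simp
    then show "\<exists>N. \<forall>n\<ge>N. nsq lborel (\<lambda>x. \<phi> n (x + z) - \<phi> n x) \<le> (norm z)\<^sup>2 * nsq lebesgue (cgrad (\<phi> n))"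
      by blast
  qed
  with m ae L nsq' that show thesis by blast
qed

text \<open>A translation \<open>z\<close> moving \<open>U\<close> off itself leaves \<open>u\<close> and its translate with disjoint supports.\<close>
lemma Poincare_zero:
  fixes u :: "'a::euclidean_space \<Rightarrow> real"
  assumes "H1_limit U u g" "nsq lebesgue g = 0" "bounded U" "U \<in> sets lebesgue"
  shows "AE x in lebesgue. u x = 0"
proof -
  obtain u' where u': "u' \<in> borel_measurable borel" "AE x in lborel. u x = u' x" "L2 lborel u'"
    "nsq lborel u' = nsq lebesgue u"
    "\<And>z. nsq lborel (\<lambda>x. u' (x + z) - u' x) \<le> (norm z)\<^sup>2 * nsq lebesgue g"
    using H1_limit_translation_bound[OF assms(1)] by blast
  obtain R where R: "\<And>x. x \<in> U \<Longrightarrow> norm x \<le> R"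
    using assms(3) by (auto simp: bounded_iff)
  obtain b :: 'a where b: "b \<in> Basis" using nonempty_Basis by blast
  \<comment> \<open>Two points of U are at most 2 |R| apart, so a vector of length 2 |R| + 1 cannot
    join them.\<close>
  define z where "z = (2 * \<bar>R\<bar> + 1) *\<^sub>R b"
  have nz: "norm z = 2 * \<bar>R\<bar> + 1"
    using b by (simp add: z_def)
  have far: "x \<notin> U \<or> x + z \<notin> U" for x
  proof (rule ccontr)
    assume "\<not> ?thesis"
    then have "norm x \<le> R" "norm (x + z) \<le> R" using R by auto
    moreover have "norm z \<le> norm (x + z) + norm x"
      using norm_triangle_ineq4[of "x + z" x] by simp
    ultimately show False using nz by linarith
  qed
  have z1: "AE x in lborel. x \<notin> U \<longrightarrow> u' x = 0"
    using H1_limit_zero_outside(1)[OF assms(1,4)] u'(2) unfolding AE_completion_iff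
    by eventually_elim auto
  have z2: "AE x in lborel. x + z \<notin> U \<longrightarrow> u' (x + z) = 0"
  proof -
    obtain N where N: "N \<in> null_sets lborel" "\<And>x. x \<notin> N \<Longrightarrow> x \<notin> U \<longrightarrow> u' x = 0"
      using z1 by (elim AE_E3) auto
    have "{x. x - (- z) \<in> N} \<in> null_sets lborel"
      by (rule null_sets_translation[OF N(1)])
    then show ?thesis
      by (rule AE_I') (use N(2) in auto)
  qed
  \<comment> \<open>With zero gradient the translation estimate makes u' invariant under z almost
    everywhere. As x or x + z lies outside U, one of the two equal values is 0.\<close>
  have "nsq lborel (\<lambda>x. u' (x + z) - u' x) = 0"
    using u'(5)[of z] assms(2) nsq_nonneg[of lborel "\<lambda>x. u' (x + z) - u' x"] by simp
  from nsq_eq_0_AE[OF L2_diff[OF L2_translate(1)[OF u'(3)] u'(3)] this]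
  have "AE x in lborel. u' (x + z) - u' x = 0" .
  with z1 z2 u'(2) have "AE x in lborel. u x = 0"
    by eventually_elim (use far in auto)
  then show ?thesis by (rule AE_completion)
qed

section \<open>Gagliardo seminorms\<close>


lemma sigma_finite_lebesgue: "sigma_finite_measure (lebesgue :: 'a::euclidean_space measure)"
proof
  obtain A :: "'a set set" where "countable A" "A \<subseteq> sets lborel" "\<Union>A = space lborel" "\<forall>a\<in>A. emeasure lborel a \<noteq> \<infinity>"
    using lborel.sigma_finite_countable by blast
  then show "\<exists>A::'a set set. countable A \<and> A \<subseteq> sets lebesgue \<and> \<Union>A = space lebesgue \<and> (\<forall>a\<in>A. emeasure lebesgue a \<noteq> \<infinity>)"
    by (intro exI[of _ A]) auto
qed

interpretation lebesgue: sigma_finite_measure lebesgue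
  by (rule sigma_finite_lebesgue)

interpretation lebesgue_pair: pair_sigma_finite lebesgue lebesgue ..

text \<open>Writing the kernel as a superposition of indicators of balls reduces radial integrals to
  volumes of balls, with no polar coordinates.\<close>

lemma powr_layer_cake:
  fixes r p :: real
  assumes "0 < r" "0 < p"
  shows "(\<integral>\<^sup>+t. ennreal (p * t powr (- p - 1)) * indicator {r..} t \<partial>lborel) = ennreal (r powr (- p))"
proof -
  have "((\<lambda>x. x powr (- p - 1)) has_integral -(r powr (- p - 1 + 1)) / (- p - 1 + 1)) {r..}"
    by (rule has_integral_powr_to_inf) (use assms in auto)
  from has_integral_mult_right[OF this, of p]
  have "((\<lambda>x. p * x powr (- p - 1)) has_integral r powr (- p)) {r..}"
    using assms by simp
  from nn_integral_has_integral_lebesgue'[OF _ this] show ?thesis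
    using assms by simp
qed

text \<open>By the layer cake formula the integral is at most that of p t^(-p-1) times the integral
  of T over the ball of radius t. The ball has volume omega t^N, and on it T is at most t^2 G, used
  for t <= 1, and at most L, used for t > 1. There remain t^(1-2s) on [0,1] and t^(-2s-1) on [1,oo),
  with integrals 1/(2-2s) and 1/(2s).\<close>

lemma nn_integral_powr_kernel_le:
  fixes T :: "'a::euclidean_space \<Rightarrow> ennreal" and s G L :: real
  assumes T: "T \<in> borel_measurable borel" "\<And>z. T z \<le> ennreal ((norm z)\<^sup>2 * G)" "\<And>z. T z \<le> ennreal L"
    and s: "0 < s" "s < 1" and GL: "0 \<le> G" "0 \<le> L"
  defines "p \<equiv> real DIM('a) + 2 * s"
  shows "(\<integral>\<^sup>+z. T z * ennreal (norm z powr (- p)) \<partial>lborel)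
    \<le> ennreal (p * unit_ball_vol (real DIM('a)) * (G / (2 - 2 * s) + L / (2 * s)))"
proof -
  let ?\<omega> = "unit_ball_vol (real DIM('a))"
  let ?w = "\<lambda>t::real. ennreal (p * t powr (- p - 1))"
  have p: "p > 0" using s by (simp add: p_def add_nonneg_pos)
  have [measurable]: "T \<in> borel_measurable borel" by fact
  have [measurable]: "{x :: 'a \<times> real. norm (fst x) \<le> snd x} \<in> sets (borel \<Otimes>\<^sub>M borel)"
    unfolding borel_prod by (intro borel_closed closed_Collect_le continuous_intros)
  have ind: "indicator {norm z..} t = (indicator {x :: 'a \<times> real. norm (fst x) \<le> snd x} (z, t) :: ennreal)" for z t
    by (simp add: indicator_def)
  have "(\<integral>\<^sup>+z. T z * ennreal (norm z powr (- p)) \<partial>lborel)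
      \<le> (\<integral>\<^sup>+z. \<integral>\<^sup>+t. T z * (?w t * indicator {norm z..} t) \<partial>lborel \<partial>lborel)"
  proof (intro nn_integral_mono)
    fix z :: 'a
    \<comment> \<open>For z = 0 the left side is 0, because 0 \<open>powr\<close> anything is 0;
      hence an inequality suffices and avoids a null set.\<close>
    have "ennreal (norm z powr (- p)) \<le> (\<integral>\<^sup>+t. ?w t * indicator {norm z..} t \<partial>lborel)"
      using powr_layer_cake[of "norm z" p] p by (cases "z = 0") auto
    then show "T z * ennreal (norm z powr (- p)) \<le> (\<integral>\<^sup>+t. T z * (?w t * indicator {norm z..} t) \<partial>lborel)"
      by (subst nn_integral_cmult) (auto intro: mult_left_mono)
  qed
  also have "\<dots> = (\<integral>\<^sup>+t. \<integral>\<^sup>+z. T z * (?w t * indicator {norm z..} t) \<partial>lborel \<partial>lborel)"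
    unfolding ind by (rule lborel_pair.Fubini'[symmetric]) measurable
  also have "\<dots> \<le> (\<integral>\<^sup>+t. ennreal (p * ?\<omega> * G) * (ennreal (t powr (1 - 2 * s)) * indicator {0..1} t)
        + ennreal (p * ?\<omega> * L) * (ennreal (t powr (- 2 * s - 1)) * indicator {1..} t) \<partial>lborel)"
  proof (intro nn_integral_mono)
    fix t :: real
    have bound: "(\<integral>\<^sup>+z. T z * (?w t * indicator {norm z..} t) \<partial>lborel) \<le> ennreal (p * ?\<omega> * B * t powr (- 2 * s - 1))"
      if t: "0 < t" and B: "0 \<le> B" "\<And>z::'a. norm z \<le> t \<Longrightarrow> T z \<le> ennreal B" for B
    proof -
      have "(\<integral>\<^sup>+z. T z * (?w t * indicator {norm z..} t) \<partial>lborel) \<le> (\<integral>\<^sup>+z. ennreal B * ?w t * indicator (cball 0 t) (z::'a) \<partial>lborel)"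
        using B by (intro nn_integral_mono) (auto simp: indicator_def intro: mult_right_mono)
      also have "\<dots> = ennreal B * ?w t * emeasure lborel (cball (0::'a) t)"
        by (rule nn_integral_cmult_indicator) simp
      also have "\<dots> = ennreal B * ?w t * ennreal (?\<omega> * t ^ DIM('a))"
        using t by (simp add: emeasure_cball)
      also have "\<dots> = ennreal (B * (p * t powr (- p - 1)) * (?\<omega> * t ^ DIM('a)))"
        using t p B by (simp add: ennreal_mult)
      also have "B * (p * t powr (- p - 1)) * (?\<omega> * t ^ DIM('a)) = p * ?\<omega> * B * (t powr (- p - 1) * t powr (real DIM('a)))"
        using t by (simp add: powr_realpow)
      also have "t powr (- p - 1) * t powr (real DIM('a)) = t powr (- 2 * s - 1)"
        by (simp add: powr_add[symmetric] p_def)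
      finally show ?thesis .
    qed
    consider "t \<le> 0" | "0 < t" "t \<le> 1" | "1 < t" by linarith
    then show "(\<integral>\<^sup>+z. T z * (?w t * indicator {norm z..} t) \<partial>lborel) \<le>
        ennreal (p * ?\<omega> * G) * (ennreal (t powr (1 - 2 * s)) * indicator {0..1} t)
        + ennreal (p * ?\<omega> * L) * (ennreal (t powr (- 2 * s - 1)) * indicator {1..} t)"
    proof cases
      case 1
      \<comment> \<open>A negative t admits no z, and at t = 0 the weight is 0 by the convention for
        0 \<open>powr\<close>.\<close>
      have "?w t * indicator {norm z..} t = 0" for z :: 'a
      proof (cases "t = 0")
        case False
        then have "\<not> norm z \<le> t" using 1 norm_ge_zero[of z] by linarith
        then show ?thesis by simp
      qed simp
      then have "(\<integral>\<^sup>+z. T z * (?w t * indicator {norm z..} t) \<partial>lborel) = 0"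
        by (simp only: mult_zero_right nn_integral_const) simp
      then show ?thesis by simp
    next
      case 2
      have "(\<integral>\<^sup>+z. T z * (?w t * indicator {norm z..} t) \<partial>lborel) \<le> ennreal (p * ?\<omega> * (t\<^sup>2 * G) * t powr (- 2 * s - 1))"
      proof (rule bound)
        fix z :: 'a assume "norm z \<le> t"
        then have "(norm z)\<^sup>2 * G \<le> t\<^sup>2 * G" using GL by (intro mult_right_mono power_mono) auto
        then show "T z \<le> ennreal (t\<^sup>2 * G)"
          using T(2)[of z] by (metis ennreal_leI order_trans)
      qed (use 2 GL in auto)
      also have "p * ?\<omega> * (t\<^sup>2 * G) * t powr (- 2 * s - 1) = p * ?\<omega> * G * (t powr 2 * t powr (- 2 * s - 1))"
        using 2 by (simp add: powr_realpow[of t 2, simplified])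
      also have "t powr 2 * t powr (- 2 * s - 1) = t powr (1 - 2 * s)"
        by (simp add: powr_add[symmetric])
      finally have "(\<integral>\<^sup>+z. T z * (?w t * indicator {norm z..} t) \<partial>lborel)
          \<le> ennreal (p * ?\<omega> * G) * (ennreal (t powr (1 - 2 * s)) * indicator {0..1} t)"
        using 2 p GL by (simp add: ennreal_mult)
      then show ?thesis by (rule order_trans) simp
    next
      case 3
      have "(\<integral>\<^sup>+z. T z * (?w t * indicator {norm z..} t) \<partial>lborel) \<le> ennreal (p * ?\<omega> * L * t powr (- 2 * s - 1))"
        by (rule bound) (use 3 GL T(3) in auto)
      then have "(\<integral>\<^sup>+z. T z * (?w t * indicator {norm z..} t) \<partial>lborel)
          \<le> ennreal (p * ?\<omega> * L) * (ennreal (t powr (- 2 * s - 1)) * indicator {1..} t)"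
        using 3 p GL by (simp add: ennreal_mult)
      then show ?thesis by (rule order_trans) simp
    qed
  qed
  also have "\<dots> = ennreal (p * ?\<omega> * G) * ennreal (1 / (2 - 2 * s)) + ennreal (p * ?\<omega> * L) * ennreal (1 / (2 * s))"
  proof -
    have "(\<integral>\<^sup>+t. ennreal (t powr (1 - 2 * s)) * indicator {0..1} t \<partial>lborel) = ennreal (1 / (2 - 2 * s))"
      using nn_integral_has_integral_lebesgue'[OF _ has_integral_powr_from_0[of "1 - 2 * s" 1]] s by simp
    moreover have "(\<integral>\<^sup>+t. ennreal (t powr (- 2 * s - 1)) * indicator {1..} t \<partial>lborel) = ennreal (1 / (2 * s))"
      using nn_integral_has_integral_lebesgue'[OF _ has_integral_powr_to_inf[of "- 2 * s - 1" 1]] s by simp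
    ultimately show ?thesis
      by (simp add: nn_integral_add nn_integral_cmult)
  qed
  also have "\<dots> = ennreal (p * ?\<omega> * (G / (2 - 2 * s) + L / (2 * s)))"
    using p s GL by (simp add: ennreal_mult[symmetric] ennreal_plus[symmetric] distrib_left del: ennreal_plus)
  finally show ?thesis .
qed

text \<open>Half of the kernel exponent goes to each factor, so that \<open>frac_form\<close>
  becomes a multiple of an L^2 inner product on the product space and inherits bilinearity and
  Cauchy-Schwarz from \<open>ip\<close>. On the diagonal the value is 0.\<close>

definition diff_quot :: "real \<Rightarrow> ('a::euclidean_space \<Rightarrow> real) \<Rightarrow> 'a \<times> 'a \<Rightarrow> real" where
  "diff_quot s u = (\<lambda>(x, y). (u x - u y) / norm (x - y) powr ((real DIM('a) + 2 * s) / 2))"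

lemma frac_form_eq_ip:
  fixes u v :: "'a::euclidean_space \<Rightarrow> real"
  assumes "s \<noteq> 0"
  shows "frac_form s u v = cNs DIM('a) s * ip (lebesgue \<Otimes>\<^sub>M lebesgue) (diff_quot s u) (diff_quot s v)"
proof -
  have "r powr (real DIM('a) + 2 * s) = r powr ((real DIM('a) + 2 * s) / 2) * r powr ((real DIM('a) + 2 * s) / 2)" for r :: real
    by (simp add: powr_add[symmetric])
  then show ?thesis
    using assms by (simp add: frac_form_def ip_def diff_quot_def case_prod_unfold)
qed

lemma borel_measurable_lebesgue_pair:
  "fst \<in> lebesgue \<Otimes>\<^sub>M lebesgue \<rightarrow>\<^sub>M borel" "snd \<in> lebesgue \<Otimes>\<^sub>M lebesgue \<rightarrow>\<^sub>M borel"
  by (rule measurable_compose[OF measurable_fst] measurable_compose[OF measurable_snd],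
      rule measurable_completion, simp)+

text \<open>Joint measurability including s is what makes the form a measurable function of s, hence
  integrable against \<open>\<mu>\<close>.\<close>

lemma diff_quot_measurable_param:
  fixes u :: "'a::euclidean_space \<Rightarrow> real"
  assumes u: "u \<in> borel_measurable lebesgue"
  shows "(\<lambda>(s, p). diff_quot s u p) \<in> borel_measurable (borel \<Otimes>\<^sub>M (lebesgue \<Otimes>\<^sub>M lebesgue))"
proof -
  let ?M = "borel \<Otimes>\<^sub>M (lebesgue \<Otimes>\<^sub>M lebesgue) :: (real \<times> 'a \<times> 'a) measure"
  note [measurable] = u
  have [measurable]: "(\<lambda>q. fst (snd q)) \<in> ?M \<rightarrow>\<^sub>M borel" "(\<lambda>q. snd (snd q)) \<in> ?M \<rightarrow>\<^sub>M borel"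
    by (rule measurable_compose[OF measurable_snd borel_measurable_lebesgue_pair(1)]
        measurable_compose[OF measurable_snd borel_measurable_lebesgue_pair(2)])+
  have [measurable]: "(\<lambda>q. u (fst (snd q))) \<in> ?M \<rightarrow>\<^sub>M borel" "(\<lambda>q. u (snd (snd q))) \<in> ?M \<rightarrow>\<^sub>M borel"
    by measurable
  show ?thesis
    unfolding diff_quot_def case_prod_unfold by measurable
qed

lemma diff_quot_measurable:
  fixes u :: "'a::euclidean_space \<Rightarrow> real"
  assumes "u \<in> borel_measurable lebesgue"
  shows "diff_quot s u \<in> borel_measurable (lebesgue \<Otimes>\<^sub>M lebesgue)"
  using measurable_Pair2[OF diff_quot_measurable_param[OF assms], of s] by simp

text \<open>Substituting y = x + z and exchanging the integrals turns the double integral into T(z)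
  |z|^(-p), where T(z) is the squared L^2 norm of the difference between u and its translate by z.
  The translation estimate bounds T for small z, the triangle inequality for large z, and the kernel
  bound applies.\<close>

lemma diff_quot_L2:
  fixes u :: "'a::euclidean_space \<Rightarrow> real"
  assumes u: "H1_limit U u g" and s: "0 < s" "s < 1"
  shows "L2 (lebesgue \<Otimes>\<^sub>M lebesgue) (diff_quot s u)" (is ?L2)
    and "nsq (lebesgue \<Otimes>\<^sub>M lebesgue) (diff_quot s u) \<le> (real DIM('a) + 2 * s) * unit_ball_vol (real DIM('a)) *
      (nsq lebesgue g / (2 - 2 * s) + 4 * nsq lebesgue u / (2 * s))" (is "_ \<le> ?B")
proof -
  let ?p = "real DIM('a) + 2 * s"
  obtain u' where u': "u' \<in> borel_measurable borel" "AE x in lborel. u x = u' x" "L2 lborel u'"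
    "nsq lborel u' = nsq lebesgue u"
    "\<And>z. nsq lborel (\<lambda>x. u' (x + z) - u' x) \<le> (norm z)\<^sup>2 * nsq lebesgue g"
    using H1_limit_translation_bound[OF u] by blast
  note [measurable] = u'(1)
  have meas: "diff_quot s u \<in> borel_measurable (lebesgue \<Otimes>\<^sub>M lebesgue)"
    by (rule diff_quot_measurable[OF L2_measurable[OF H1_limit_L2[OF u]]])
  have sq: "(diff_quot s w (x, y))\<^sup>2 = (w x - w y)\<^sup>2 * norm (x - y) powr (- ?p)" for w :: "'a \<Rightarrow> real" and x y
  proof -
    have "(norm (x - y) powr (?p / 2))\<^sup>2 = norm (x - y) powr ?p"
      unfolding power2_eq_square powr_add[symmetric] by simp
    moreover have "norm (x - y) powr (- ?p) = inverse (norm (x - y) powr ?p)"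
      by (rule powr_minus)
    ultimately show ?thesis
      by (simp only: diff_quot_def case_prod_conv power_divide) (simp only: divide_inverse)
  qed
  define T where "T z = (\<integral>\<^sup>+x. ennreal ((u' (x + z) - u' x)\<^sup>2) \<partial>lborel)" for z
  have T_eq: "T z = ennreal (nsq lborel (\<lambda>x. u' (x + z) - u' x))" for z
    using nn_integral_eq_nsq[OF L2_diff[OF L2_translate(1)[OF u'(3)] u'(3)], of z] by (simp add: T_def)
  have "(\<integral>\<^sup>+q. ennreal ((diff_quot s u q)\<^sup>2) \<partial>(lebesgue \<Otimes>\<^sub>M lebesgue))
      = (\<integral>\<^sup>+x. \<integral>\<^sup>+y. ennreal ((diff_quot s u (x, y))\<^sup>2) \<partial>lebesgue \<partial>lebesgue)"
    by (rule lebesgue.nn_integral_fst[symmetric]) (use meas in measurable)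
  also have "\<dots> = (\<integral>\<^sup>+x. \<integral>\<^sup>+y. ennreal ((diff_quot s u (x, y))\<^sup>2) \<partial>lborel \<partial>lborel)"
    by (simp add: nn_integral_completion)
  \<comment> \<open>The Borel representative enters slice by slice, before the substitution y = x +
    z, which evaluates it at a sum of the variables.\<close>
  also have "\<dots> = (\<integral>\<^sup>+x. \<integral>\<^sup>+y. ennreal ((diff_quot s u' (x, y))\<^sup>2) \<partial>lborel \<partial>lborel)"
  proof (rule nn_integral_cong_AE, use u'(2) in eventually_elim)
    fix x assume x: "u x = u' x"
    show "(\<integral>\<^sup>+y. ennreal ((diff_quot s u (x, y))\<^sup>2) \<partial>lborel) = (\<integral>\<^sup>+y. ennreal ((diff_quot s u' (x, y))\<^sup>2) \<partial>lborel)"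
      by (rule nn_integral_cong_AE, use u'(2) in eventually_elim) (simp add: x diff_quot_def)
  qed
  also have "\<dots> = (\<integral>\<^sup>+x. \<integral>\<^sup>+z. ennreal ((u' (x + z) - u' x)\<^sup>2 * norm z powr (- ?p)) \<partial>lborel \<partial>lborel)"
  proof (rule nn_integral_cong)
    fix x :: 'a
    have "(\<integral>\<^sup>+y. ennreal ((diff_quot s u' (x, y))\<^sup>2) \<partial>lborel) = (\<integral>\<^sup>+z. ennreal ((diff_quot s u' (x, z + x))\<^sup>2) \<partial>lborel)"
      unfolding sq by (rule nn_integral_translate[symmetric]) measurable
    also have "\<dots> = (\<integral>\<^sup>+z. ennreal ((u' (x + z) - u' x)\<^sup>2 * norm z powr (- ?p)) \<partial>lborel)"
      unfolding sq by (simp add: add.commute power2_commute)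
    finally show "(\<integral>\<^sup>+y. ennreal ((diff_quot s u' (x, y))\<^sup>2) \<partial>lborel)
      = (\<integral>\<^sup>+z. ennreal ((u' (x + z) - u' x)\<^sup>2 * norm z powr (- ?p)) \<partial>lborel)" .
  qed
  also have "\<dots> = (\<integral>\<^sup>+z. \<integral>\<^sup>+x. ennreal ((u' (x + z) - u' x)\<^sup>2 * norm z powr (- ?p)) \<partial>lborel \<partial>lborel)"
    by (rule lborel_pair.Fubini'[symmetric]) measurable
  also have "\<dots> = (\<integral>\<^sup>+z. T z * ennreal (norm z powr (- ?p)) \<partial>lborel)"
    unfolding T_def by (simp add: ennreal_mult nn_integral_multc)
  also have "\<dots> \<le> ennreal ?B"
  proof (rule nn_integral_powr_kernel_le[OF _ _ _ s])
    show "T \<in> borel_measurable borel"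
      unfolding T_def by measurable
    show "T z \<le> ennreal ((norm z)\<^sup>2 * nsq lebesgue g)" for z
      unfolding T_eq by (intro ennreal_leI u'(5))
    show "T z \<le> ennreal (4 * nsq lebesgue u)" for z
      unfolding T_eq using nsq_diff_le[OF L2_translate(1)[OF u'(3)] u'(3), of z] u'(4) L2_translate(2)[OF u'(3), of z]
      by (intro ennreal_leI) simp
  qed simp_all
  finally have le: "(\<integral>\<^sup>+q. ennreal ((diff_quot s u q)\<^sup>2) \<partial>(lebesgue \<Otimes>\<^sub>M lebesgue)) \<le> ennreal ?B" .
  then have "integrable (lebesgue \<Otimes>\<^sub>M lebesgue) (\<lambda>q. (diff_quot s u q)\<^sup>2)"
    using meas le_less_trans[OF le ennreal_less_top] by (intro integrableI_bounded) auto
  then show L2: ?L2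
    using meas by (simp add: L2_def)
  have "0 \<le> ?B" using s by simp
  then show "nsq (lebesgue \<Otimes>\<^sub>M lebesgue) (diff_quot s u) \<le> ?B"
    using le nn_integral_eq_nsq[OF L2] by (simp add: ennreal_le_iff)
qed

section \<open>The form integrated over the order\<close>


lemma diff_quot_lincomb:
  "diff_quot s (\<lambda>x. a * u x + b * v x) = (\<lambda>q. a *\<^sub>R diff_quot s u q + b *\<^sub>R diff_quot s v q)"
  by (auto simp: diff_quot_def fun_eq_iff algebra_simps add_divide_distrib diff_divide_distrib)

lemma frac_form_commute: "frac_form s u v = frac_form s v u"
  by (simp add: frac_form_def mult.commute)

lemma frac_form_lincomb_right:
  fixes u v w :: "'a::euclidean_space \<Rightarrow> real"
  assumes "H1_limit U u g" "H1_limit V v h" "H1_limit W w k" "s \<in> {0..<1}"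
  shows "frac_form s w (\<lambda>x. a * u x + b * v x) = a * frac_form s w u + b * frac_form s w v"
proof (cases "s = 0")
  case True
  then show ?thesis
    using ip_lincomb_right[OF H1_limit_L2[OF assms(1)] H1_limit_L2[OF assms(2)] H1_limit_L2[OF assms(3)], of a b]
    by (simp add: frac_form_def ip_def)
next
  case False
  with assms(4) have s: "0 < s" "s < 1" by auto
  show ?thesis
    using False ip_lincomb_right[OF diff_quot_L2(1)[OF assms(1) s] diff_quot_L2(1)[OF assms(2) s]
        diff_quot_L2(1)[OF assms(3) s], of a b]
    by (simp add: frac_form_eq_ip diff_quot_lincomb distrib_left)
qed

text \<open>The part of \<open>cNs\<close> that is continuous and positive on all of [0,1]. The
  remaining factor s (1 - s) is kept apart to cancel the poles in
  \<open>diff_quot_L2\<close>.\<close>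

definition cNs_factor :: "nat \<Rightarrow> real \<Rightarrow> real" where
  "cNs_factor n s = 2 powr (2 * s - 1) * Gamma ((real n + 2 * s) / 2) / (pi powr (real n / 2) * Gamma (2 - s))"

lemma cNs_eq: "cNs n s = cNs_factor n s * s * (1 - s)"
  by (simp add: cNs_def cNs_factor_def)

lemma cNs_factor_pos: "0 \<le> s \<Longrightarrow> s \<le> 1 \<Longrightarrow> 0 < n \<Longrightarrow> 0 < cNs_factor n s"
  unfolding cNs_factor_def
  by (intro divide_pos_pos mult_pos_pos Gamma_real_pos) (auto simp: add_pos_nonneg)

lemma cNs_pos: "0 < s \<Longrightarrow> s < 1 \<Longrightarrow> 0 < n \<Longrightarrow> 0 < cNs n s"
  unfolding cNs_eq by (intro mult_pos_pos cNs_factor_pos) auto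

lemma continuous_on_cNs_factor:
  assumes "0 < n" shows "continuous_on {0..1} (cNs_factor n)"
proof -
  have "(real n + 2 * s) / 2 \<notin> \<int>\<^sub>\<le>\<^sub>0" "2 - s \<notin> \<int>\<^sub>\<le>\<^sub>0" if "s \<in> {0..1}" for s :: real
    using that assms by (auto elim!: nonpos_Ints_cases)
  moreover have "Gamma (2 - s) \<noteq> 0" if "s \<in> {0..1}" for s :: real
  proof -
    have "0 < Gamma (2 - s)" using that by (intro Gamma_real_pos) auto
    then show ?thesis by linarith
  qed
  ultimately show ?thesis
    unfolding cNs_factor_def
    by (intro continuous_at_imp_continuous_on ballI continuous_intros) auto
qed

lemma cNs_factor_bounded:
  assumes "0 < n"
  obtains K where "0 \<le> K" "\<And>s. s \<in> {0..1} \<Longrightarrow> cNs_factor n s \<le> K"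
proof -
  have "compact (cNs_factor n ` {0..1})"
    by (intro compact_continuous_image continuous_on_cNs_factor assms) simp
  then have "bounded (cNs_factor n ` {0..1})"
    by (rule compact_imp_bounded)
  then obtain K where K: "\<forall>y\<in>cNs_factor n ` {0..1}. norm y \<le> K"
    unfolding bounded_iff by blast
  have "cNs_factor n s \<le> \<bar>K\<bar>" if "s \<in> {0..1}" for s
    using bspec[OF K imageI[OF that]] by simp
  then show thesis by (intro that[of "\<bar>K\<bar>"]) auto
qed

lemma frac_form_nonneg:
  fixes u :: "'a::euclidean_space \<Rightarrow> real"
  assumes "s \<in> {0..<1}"
  shows "0 \<le> frac_form s u u"
proof (cases "s = 0")
  case False
  then show ?thesis
    using assms cNs_pos[of s "DIM('a)"] by (simp add: frac_form_eq_ip nsq_ip[symmetric])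
qed (simp add: frac_form_def)

text \<open>Uniform in s: s (1 - s) (G/(2-2s) + 4L/(2s)) equals s G/2 + 2 (1-s) L, which is at most
  2 (L + G), and \<open>cNs_factor\<close> is bounded by K on [0,1]. The summand 1 in the constant
  covers s = 0, where the form is the squared L^2 norm.\<close>

lemma frac_form_le:
  obtains C where "0 \<le> C" "\<And>(u :: 'a::euclidean_space \<Rightarrow> real) g U s.
    H1_limit U u g \<Longrightarrow> s \<in> {0..<1} \<Longrightarrow> frac_form s u u \<le> C * (nsq lebesgue u + nsq lebesgue g)"
proof -
  obtain K where K: "0 \<le> K" "\<And>s. s \<in> {0..1} \<Longrightarrow> cNs_factor DIM('a) s \<le> K"
    using cNs_factor_bounded[of "DIM('a)"] by auto
  let ?N = "real DIM('a)"
  let ?W = "(?N + 2) * unit_ball_vol ?N"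
  have W: "0 \<le> ?W" by simp
  have "frac_form s u u \<le> (1 + 2 * K * ?W) * (nsq lebesgue u + nsq lebesgue g)"
    if u: "H1_limit U u g" and s: "s \<in> {0..<1}" for u :: "'a \<Rightarrow> real" and g U s
  proof (cases "s = 0")
    case True
    have "frac_form s u u = nsq lebesgue u"
      using True by (simp add: frac_form_def nsq_def power2_eq_square)
    also have "\<dots> \<le> (1 + 2 * K * ?W) * (nsq lebesgue u + nsq lebesgue g)"
    proof -
      have "nsq lebesgue u \<le> 1 * (nsq lebesgue u + nsq lebesgue g)"
        by simp
      also have "\<dots> \<le> (1 + 2 * K * ?W) * (nsq lebesgue u + nsq lebesgue g)"
        using W K(1) by (intro mult_right_mono) auto
      finally show ?thesis .
    qed
    finally show ?thesis .
  next
    case False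
    then have s: "0 < s" "s < 1" using s by auto
    let ?L = "nsq lebesgue u" and ?G = "nsq lebesgue g"
    have "frac_form s u u = cNs_factor DIM('a) s * (s * (1 - s) * nsq (lebesgue \<Otimes>\<^sub>M lebesgue) (diff_quot s u))"
      using s by (simp add: frac_form_eq_ip nsq_ip cNs_eq)
    also have "\<dots> \<le> K * (s * (1 - s) * nsq (lebesgue \<Otimes>\<^sub>M lebesgue) (diff_quot s u))"
      using s by (intro mult_right_mono K) auto
    also have "\<dots> \<le> K * (s * (1 - s) * ((?N + 2 * s) * unit_ball_vol ?N * (?G / (2 - 2 * s) + 4 * ?L / (2 * s))))"
      using s K(1) by (intro mult_left_mono diff_quot_L2(2)[OF u]) auto
    also have "s * (1 - s) * ((?N + 2 * s) * unit_ball_vol ?N * (?G / (2 - 2 * s) + 4 * ?L / (2 * s)))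
        = (?N + 2 * s) * unit_ball_vol ?N * (s * ?G / 2 + 2 * (1 - s) * ?L)"
    proof -
      have *: "a * (b * c * e) = b * c * (a * e)" for a b c e :: real
        by (simp only: ac_simps)
      have "s * (1 - s) * (?G / (2 - 2 * s) + 4 * ?L / (2 * s)) = s * ?G / 2 + 2 * (1 - s) * ?L"
        using s by (simp add: divide_simps) (simp add: algebra_simps)
      then show ?thesis by (simp only: *)
    qed
    also have "K * \<dots> \<le> K * (?W * (2 * (?L + ?G)))"
    proof -
      have *: "a / 2 + b \<le> 2 * (L + G)" if "a \<le> 1 * G" "b \<le> 2 * L" "0 \<le> G" for a b L G :: real
        using that by simp
      have "s * ?G \<le> 1 * ?G" using s by (intro mult_right_mono) auto
      moreover have "2 * (1 - s) * ?L \<le> 2 * ?L" using s by (intro mult_right_mono) auto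
      ultimately have "s * ?G / 2 + 2 * (1 - s) * ?L \<le> 2 * (?L + ?G)"
        by (rule *) simp
      moreover have "0 \<le> s * ?G / 2 + 2 * (1 - s) * ?L" using s by simp
      ultimately show ?thesis
        using s K(1) by (intro mult_left_mono mult_mono) auto
    qed
    also have "\<dots> \<le> (1 + 2 * K * ?W) * (?L + ?G)"
      by (simp add: algebra_simps)
    finally show ?thesis .
  qed
  moreover have "0 \<le> 1 + 2 * K * ?W" using W K(1) by simp
  ultimately show thesis using that by blast
qed

lemma frac_form_Cauchy_Schwarz:
  fixes u v :: "'a::euclidean_space \<Rightarrow> real"
  assumes "H1_limit U u g" "H1_limit V v h" "s \<in> {0..<1}"
  shows "(frac_form s u v)\<^sup>2 \<le> frac_form s u u * frac_form s v v"
proof (cases "s = 0")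
  case True
  then show ?thesis
    using ip_Cauchy_Schwarz[OF H1_limit_L2[OF assms(1)] H1_limit_L2[OF assms(2)]]
    by (simp add: frac_form_def ip_def nsq_def power2_eq_square)
next
  case False
  with assms(3) have s: "0 < s" "s < 1" by auto
  have "(cNs DIM('a) s)\<^sup>2 * (ip (lebesgue \<Otimes>\<^sub>M lebesgue) (diff_quot s u) (diff_quot s v))\<^sup>2 \<le> (cNs DIM('a) s)\<^sup>2 *
      (nsq (lebesgue \<Otimes>\<^sub>M lebesgue) (diff_quot s u) * nsq (lebesgue \<Otimes>\<^sub>M lebesgue) (diff_quot s v))"
    by (intro mult_left_mono ip_Cauchy_Schwarz diff_quot_L2(1)[OF assms(1) s] diff_quot_L2(1)[OF assms(2) s]) auto
  then show ?thesis
    using False by (simp add: frac_form_eq_ip nsq_ip power_mult_distrib power2_eq_square mult.assoc mult.left_commute)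
qed

text \<open>Away from s = 0 the form is a continuous factor times a parametrized integral. At s = 0
  that formula would give 0 instead of the L^2 product, so this one point is split off.\<close>

lemma frac_form_measurable:
  fixes u v :: "'a::euclidean_space \<Rightarrow> real"
  assumes "u \<in> borel_measurable lebesgue" "v \<in> borel_measurable lebesgue"
  shows "(\<lambda>s. indicator {0..<1} s * frac_form s u v) \<in> borel_measurable borel"
proof -
  have "(\<lambda>(s, q). diff_quot s u q * diff_quot s v q) \<in> borel_measurable (borel \<Otimes>\<^sub>M (lebesgue \<Otimes>\<^sub>M lebesgue))"
    using borel_measurable_times[OF diff_quot_measurable_param[OF assms(1)] diff_quot_measurable_param[OF assms(2)]]
    by (simp add: case_prod_unfold)
  then have ip: "(\<lambda>s. ip (lebesgue \<Otimes>\<^sub>M lebesgue) (diff_quot s u) (diff_quot s v)) \<in> borel_measurable borel"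
    unfolding ip_def inner_real_def by (rule sigma_finite_measure.borel_measurable_lebesgue_integral[OF lebesgue_pair.sigma_finite_measure_axioms])
  have c: "(\<lambda>s. indicator {0..1} s *\<^sub>R cNs_factor DIM('a) s) \<in> borel_measurable borel"
    by (intro borel_measurable_continuous_on_indicator continuous_on_cNs_factor) auto
  note [measurable] = ip c
  have "(\<lambda>s. indicator {0..<1} s * frac_form s u v) = (\<lambda>s. if s = 0 then frac_form 0 u v else
      indicator {0..<1} s * ((indicator {0..1} s *\<^sub>R cNs_factor DIM('a) s) * s * (1 - s) *
        ip (lebesgue \<Otimes>\<^sub>M lebesgue) (diff_quot s u) (diff_quot s v)))"
    by (auto simp: fun_eq_iff frac_form_eq_ip cNs_eq indicator_def)
  also have "\<dots> \<in> borel_measurable borel"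
    by measurable
  finally show ?thesis .
qed

section \<open>The form integrated over s, symmetric bilinear and continuous in the H^1 norm\<close>

locale interval_measure = finite_measure \<mu> for \<mu> :: "real measure" +
  assumes sets_eq: "sets \<mu> = sets (restrict_space borel {0..1::real})"
begin

lemma measurable_from_borel: "f \<in> borel_measurable borel \<Longrightarrow> f \<in> borel_measurable \<mu>"
  using measurable_restrict_space1[of f borel borel "{0..1}"] measurable_cong_sets[OF sets_eq refl] by blast

lemma mu_form_eq: "mu_form \<mu> u v = (\<integral>s. indicator {0..<1} s * frac_form s u v \<partial>\<mu>)"
  by (simp add: mu_form_def set_lebesgue_integral_def)

text \<open>Cauchy-Schwarz for each s and the uniform bound \<open>frac_form_le\<close> give a
  constant majorant, integrable because \<open>\<mu>\<close> is finite.\<close>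

lemma frac_form_integrable:
  fixes u v :: "'a::euclidean_space \<Rightarrow> real"
  assumes "H1_limit U u g" "H1_limit V v h"
  shows "integrable \<mu> (\<lambda>s. indicator {0..<1} s * frac_form s u v)"
proof -
  obtain C where C: "0 \<le> C" "\<And>(u :: 'a \<Rightarrow> real) g U s.
    H1_limit U u g \<Longrightarrow> s \<in> {0..<1} \<Longrightarrow> frac_form s u u \<le> C * (nsq lebesgue u + nsq lebesgue g)"
    using frac_form_le by blast
  define A where "A = C * (nsq lebesgue u + nsq lebesgue g)"
  define B where "B = C * (nsq lebesgue v + nsq lebesgue h)"
  have AB: "0 \<le> A" "0 \<le> B" using C(1) by (auto simp: A_def B_def)
  have "norm (indicator {0..<1} s * frac_form s u v) \<le> sqrt (A * B)" for s
  proof (cases "s \<in> {0..<1}")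
    case True
    have "(frac_form s u v)\<^sup>2 \<le> frac_form s u u * frac_form s v v"
      by (rule frac_form_Cauchy_Schwarz[OF assms True])
    also have "\<dots> \<le> A * B"
      unfolding A_def B_def using C True assms by (intro mult_mono frac_form_nonneg) auto
    finally show ?thesis using True by (simp add: real_le_rsqrt)
  qed (use AB in auto)
  then show ?thesis
    by (intro integrable_const_bound[of _ "sqrt (A * B)"])
      (auto intro: measurable_from_borel frac_form_measurable[OF L2_measurable[OF H1_limit_L2[OF assms(1)]]
          L2_measurable[OF H1_limit_L2[OF assms(2)]]])
qed

lemma mu_form_commute: "mu_form \<mu> u v = mu_form \<mu> v u"
  unfolding mu_form_def by (simp add: frac_form_commute)

lemma mu_form_lincomb_right:
  fixes u v w :: "'a::euclidean_space \<Rightarrow> real"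
  assumes "H1_limit U u g" "H1_limit V v h" "H1_limit W w k"
  shows "mu_form \<mu> w (\<lambda>x. a * u x + b * v x) = a * mu_form \<mu> w u + b * mu_form \<mu> w v"
proof -
  have "mu_form \<mu> w (\<lambda>x. a * u x + b * v x)
      = (\<integral>s. a * (indicator {0..<1} s * frac_form s w u) + b * (indicator {0..<1} s * frac_form s w v) \<partial>\<mu>)"
    unfolding mu_form_eq
    by (intro Bochner_Integration.integral_cong refl) (auto simp: indicator_def frac_form_lincomb_right[OF assms])
  then show ?thesis
    by (simp add: mu_form_eq frac_form_integrable[OF assms(3,1)] frac_form_integrable[OF assms(3,2)])
qed

lemma mu_form_lincomb_left:
  fixes u v w :: "'a::euclidean_space \<Rightarrow> real"
  assumes "H1_limit U u g" "H1_limit V v h" "H1_limit W w k"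
  shows "mu_form \<mu> (\<lambda>x. a * u x + b * v x) w = a * mu_form \<mu> u w + b * mu_form \<mu> v w"
  using mu_form_lincomb_right[OF assms] by (simp add: mu_form_commute)

lemma mu_form_nonneg: "0 \<le> mu_form \<mu> u u"
  unfolding mu_form_eq by (intro integral_nonneg_AE AE_I2) (auto simp: indicator_def frac_form_nonneg)

lemma mu_form_lincomb_self:
  fixes u v :: "'a::euclidean_space \<Rightarrow> real"
  assumes "H1_limit U u g" "H1_limit U v h"
  shows "mu_form \<mu> (\<lambda>x. a * u x + b * v x) (\<lambda>x. a * u x + b * v x)
    = a\<^sup>2 * mu_form \<mu> u u + 2 * a * b * mu_form \<mu> u v + b\<^sup>2 * mu_form \<mu> v v"
  using H1_limit_lincomb[OF assms, of a b] assms
  by (simp add: mu_form_lincomb_right mu_form_lincomb_left mu_form_commute[of v u] power2_eq_square algebra_simps)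

lemma mu_form_Cauchy_Schwarz:
  fixes u v :: "'a::euclidean_space \<Rightarrow> real"
  assumes "H1_limit U u g" "H1_limit U v h"
  shows "(mu_form \<mu> u v)\<^sup>2 \<le> mu_form \<mu> u u * mu_form \<mu> v v"
proof (rule discriminant_nonpos)
  fix t
  show "0 \<le> mu_form \<mu> u u + 2 * t * mu_form \<mu> u v + t\<^sup>2 * mu_form \<mu> v v"
    using mu_form_lincomb_self[OF assms, of 1 t] mu_form_nonneg[of "\<lambda>x. 1 * u x + t * v x"] by simp
qed (rule mu_form_nonneg)

text \<open>Continuity under H^1 convergence: Cauchy-Schwarz for \<open>mu_form\<close> reduces it
  to the form at the difference, which \<open>frac_form_le\<close> bounds by the total mass times
  the squared H^1 distance.\<close>

lemma mu_form_tendsto: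
  fixes u v :: "'a::euclidean_space \<Rightarrow> real"
  assumes "H1_limit U u g" "H1_limit V v h" "\<And>k. test_fun V (\<phi> k)"
    and "(\<lambda>k. nsq lebesgue (\<lambda>x. \<phi> k x - v x)) \<longlonglongrightarrow> 0"
    and "(\<lambda>k. nsq lebesgue (\<lambda>x. cgrad (\<phi> k) x - h x)) \<longlonglongrightarrow> 0"
  shows "(\<lambda>k. mu_form \<mu> u (\<phi> k)) \<longlonglongrightarrow> mu_form \<mu> u v"
proof -
  obtain C where C: "0 \<le> C" "\<And>(u :: 'a \<Rightarrow> real) g U s.
    H1_limit U u g \<Longrightarrow> s \<in> {0..<1} \<Longrightarrow> frac_form s u u \<le> C * (nsq lebesgue u + nsq lebesgue g)"
    using frac_form_le by blast
  let ?e = "\<lambda>k. nsq lebesgue (\<lambda>x. \<phi> k x - v x) + nsq lebesgue (\<lambda>x. cgrad (\<phi> k) x - h x)"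
  show ?thesis
  proof (rule tendsto_from_sq_bound)
    show "?e \<longlonglongrightarrow> 0"
      using tendsto_add[OF assms(4,5)] by simp
    fix k
    have \<phi>: "H1_limit V (\<phi> k) (cgrad (\<phi> k))" by (rule H1_limit_test_fun[OF assms(3)])
    have d: "H1_limit V (\<lambda>x. \<phi> k x - v x) (\<lambda>x. cgrad (\<phi> k) x - h x)"
      using H1_limit_lincomb[OF \<phi> assms(2), of 1 "-1"] by simp
    have "mu_form \<mu> (\<lambda>x. \<phi> k x - v x) (\<lambda>x. \<phi> k x - v x) \<le> (\<integral>s. C * ?e k \<partial>\<mu>)"
      unfolding mu_form_eq
      by (intro integral_mono frac_form_integrable[OF d d])
        (use C(1) C(2)[OF d] in \<open>auto simp: indicator_def\<close>)
    then have le: "mu_form \<mu> (\<lambda>x. \<phi> k x - v x) (\<lambda>x. \<phi> k x - v x) \<le> measure \<mu> (space \<mu>) * C * ?e k"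
      by simp
    have "(mu_form \<mu> u (\<phi> k) - mu_form \<mu> u v)\<^sup>2 = (mu_form \<mu> u (\<lambda>x. \<phi> k x - v x))\<^sup>2"
      using mu_form_lincomb_right[OF \<phi> assms(2,1), of 1 "-1"] by simp
    \<comment> \<open>Cauchy-Schwarz is stated for one common domain, so both functions are viewed
      on the whole space.\<close>
    also have "\<dots> \<le> mu_form \<mu> u u * mu_form \<mu> (\<lambda>x. \<phi> k x - v x) (\<lambda>x. \<phi> k x - v x)"
      by (rule mu_form_Cauchy_Schwarz[OF H1_limit_mono[OF assms(1) subset_UNIV] H1_limit_mono[OF d subset_UNIV]])
    also have "\<dots> \<le> mu_form \<mu> u u * (measure \<mu> (space \<mu>) * C * ?e k)"
      by (rule mult_left_mono[OF le mu_form_nonneg])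
    finally show "(mu_form \<mu> u (\<phi> k) - mu_form \<mu> u v)\<^sup>2 \<le> mu_form \<mu> u u * (measure \<mu> (space \<mu>) * C) * ?e k"
      by (simp add: mult.assoc)
  qed
qed

end

section \<open>Uniqueness of weak gradients\<close>


text \<open>The polynomial is there to make this family of smooth functions closed under differentiation.\<close>
definition exp_inv :: "real poly \<Rightarrow> real \<Rightarrow> real" where
  "exp_inv p x = (if 0 < x then poly p (1 / x) * exp (- 1 / x) else 0)"

lemma tendsto_poly_exp_neg: "((\<lambda>x::real. poly q x * exp (- x)) \<longlongrightarrow> 0) at_top"
proof -
  have "((\<lambda>x::real. \<Sum>i\<le>degree q. coeff q i * (x ^ i / exp x)) \<longlongrightarrow> (\<Sum>i\<le>degree q. coeff q i * 0)) at_top"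
    by (intro tendsto_intros tendsto_power_div_exp_0)
  then show ?thesis
    by (simp add: poly_altdef exp_minus sum_distrib_right divide_inverse mult.assoc)
qed

text \<open>For x > 0 the chain rule gives (1/x)^2 (p - p')(1/x) exp(-1/x), and
  \<open>[:0, 0, 1:]\<close> is the polynomial X^2. At 0 only the right-hand quotient matters: with
  y = 1/x it is y p(y) exp(-y), which tends to 0.\<close>

lemma exp_inv_has_field_derivative:
  "(exp_inv p has_field_derivative exp_inv ([:0, 0, 1:] * (p - pderiv p)) x) (at x)"
proof -
  consider "0 < x" | "x < 0" | "x = 0" by linarith
  then show ?thesis
  proof cases
    case 1
    have "((\<lambda>x. poly p (1 / x) * exp (- 1 / x)) has_field_derivative
        exp_inv ([:0, 0, 1:] * (p - pderiv p)) x) (at x)"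
      using 1 by (auto intro!: derivative_eq_intros DERIV_chain2[OF poly_DERIV]
          simp: exp_inv_def field_simps power2_eq_square)
    then show ?thesis
      by (rule has_field_derivative_transform_within_open[where S="{0<..}"])
        (use 1 in \<open>auto simp: exp_inv_def\<close>)
  next
    case 2
    have "((\<lambda>x. 0) has_field_derivative exp_inv ([:0, 0, 1:] * (p - pderiv p)) x) (at x)"
      using 2 by (simp add: exp_inv_def)
    then show ?thesis
      by (rule has_field_derivative_transform_within_open[where S="{..<0}"])
        (use 2 in \<open>auto simp: exp_inv_def\<close>)
  next
    case 3
    have "((\<lambda>h. exp_inv p h / h) \<longlongrightarrow> 0) (at_left 0)"
    proof (rule tendsto_eventually)
      show "\<forall>\<^sub>F h in at_left 0. exp_inv p h / h = 0"
        by (auto simp: eventually_at_filter exp_inv_def)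
    qed
    moreover have "((\<lambda>h. exp_inv p h / h) \<longlongrightarrow> 0) (at_right 0)"
    proof -
      have "((\<lambda>x::real. poly ([:0, 1:] * p) x * exp (- x)) \<longlongrightarrow> 0) at_top"
        by (rule tendsto_poly_exp_neg)
      moreover have "\<forall>\<^sub>F x::real in at_top. poly ([:0, 1:] * p) x * exp (- x) = exp_inv p (inverse x) / inverse x"
        using eventually_gt_at_top[of 0] by eventually_elim (simp add: exp_inv_def divide_inverse)
      ultimately have "((\<lambda>x::real. exp_inv p (inverse x) / inverse x) \<longlongrightarrow> 0) at_top"
        by (rule Lim_transform_eventually)
      then show ?thesis
        by (simp add: filterlim_at_right_to_top)
    qed
    ultimately have "((\<lambda>h. exp_inv p h / h) \<longlongrightarrow> 0) (at 0)"
      by (simp add: filterlim_at_split)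
    then show ?thesis
      using 3 by (simp add: has_field_derivative_iff exp_inv_def)
  qed
qed

text \<open>Closed under every \<open>partial b\<close>, so that all iterated partials are
  differentiable by induction on the list, without a formula for them. The affine argument x . v + d
  covers both opposite faces of a box.\<close>

inductive_set bump_algebra :: "('a::euclidean_space \<Rightarrow> real) set" where
  exp_inv: "(\<lambda>x. exp_inv p (x \<bullet> v + d)) \<in> bump_algebra"
| const: "(\<lambda>x. c) \<in> bump_algebra"
| add: "f \<in> bump_algebra \<Longrightarrow> g \<in> bump_algebra \<Longrightarrow> (\<lambda>x. f x + g x) \<in> bump_algebra"
| mult: "f \<in> bump_algebra \<Longrightarrow> g \<in> bump_algebra \<Longrightarrow> (\<lambda>x. f x * g x) \<in> bump_algebra"

lemma bump_algebra_partial: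
  assumes "f \<in> bump_algebra"
  shows "(\<forall>x. f differentiable (at x)) \<and> partial b f \<in> bump_algebra"
  using assms
proof induction
  case (exp_inv p v d)
  let ?q = "[:0, 0, 1:] * (p - pderiv p)"
  have D: "((\<lambda>x. exp_inv p (x \<bullet> v + d)) has_derivative (\<lambda>h. exp_inv ?q (x \<bullet> v + d) * (h \<bullet> v))) (at x)" for x
  proof -
    have "((\<lambda>x. x \<bullet> v + d) has_derivative (\<lambda>h. h \<bullet> v)) (at x)"
      by (auto intro!: derivative_eq_intros)
    from has_derivative_compose[OF this exp_inv_has_field_derivative[unfolded has_field_derivative_def]]
    show ?thesis .
  qed
  then have "partial b (\<lambda>x. exp_inv p (x \<bullet> v + d)) = (\<lambda>x. exp_inv ?q (x \<bullet> v + d) * (b \<bullet> v))"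
    using partial_eqI[OF D] by blast
  then show ?case
    using D by (auto simp: differentiable_def simp del: mult_pCons_left intro!: bump_algebra.intros)
next
  case (const c)
  have D: "((\<lambda>x. c) has_derivative (\<lambda>h. 0)) (at x)" for x :: 'a by simp
  have "partial b (\<lambda>x. c) = (\<lambda>x. 0)"
    using partial_eqI[OF D] by blast
  then show ?case
    by (auto intro: bump_algebra.const)
next
  case (add f g)
  then have "partial b (\<lambda>x. f x + g x) = (\<lambda>x. partial b f x + partial b g x)"
    using partial_lincomb[of f _ g b 1 1] by auto
  then show ?case
    using add by (auto intro: bump_algebra.add)
next
  case (mult f g)
  have "partial b (\<lambda>x. f x * g x) x = f x * partial b g x + partial b f x * g x" for x
  proof -
    obtain D E where D: "(f has_derivative D) (at x)" and E: "(g has_derivative E) (at x)"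
      using mult.IH unfolding differentiable_def by blast
    show ?thesis
      using partial_eqI[OF has_derivative_mult[OF D E]] partial_eqI[OF D] partial_eqI[OF E] by simp
  qed
  then have "partial b (\<lambda>x. f x * g x) = (\<lambda>x. f x * partial b g x + partial b f x * g x)"
    by blast
  then show ?case
    using mult by (auto intro: bump_algebra.intros)
qed

lemma bump_algebra_smooth:
  assumes "f \<in> bump_algebra" shows "smooth_fun f"
proof -
  have "foldr partial bs f \<in> bump_algebra" for bs
    by (induction bs) (use assms bump_algebra_partial in auto)
  then show ?thesis
    unfolding smooth_fun_def using bump_algebra_partial by blast
qed

lemma bump_algebra_prod:
  assumes "\<And>i. i \<in> I \<Longrightarrow> f i \<in> bump_algebra"
  shows "(\<lambda>x. \<Prod>i\<in>I. f i x) \<in> bump_algebra"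
  using assms
proof (induction I rule: infinite_finite_induct)
  case (insert i I)
  then show ?case by (auto intro: bump_algebra.mult)
qed (auto intro: bump_algebra.const)

text \<open>No normalization is needed: \<open>exp (- 1 / (n * t))\<close> tends to \<open>1\<close> for every \<open>t > 0\<close>.\<close>
definition box_bump :: "nat \<Rightarrow> 'a::euclidean_space \<Rightarrow> 'a \<Rightarrow> 'a \<Rightarrow> real" where
  "box_bump n l u x = (\<Prod>b\<in>Basis. exp_inv 1 (real (Suc n) * (x \<bullet> b - l \<bullet> b)) * exp_inv 1 (real (Suc n) * (u \<bullet> b - x \<bullet> b)))"

lemma box_bump_test_fun: "test_fun UNIV (box_bump n l u)"
proof -
  have "(\<lambda>x. exp_inv 1 (x \<bullet> (real (Suc n) *\<^sub>R b) + - real (Suc n) * (l \<bullet> b)) *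
      exp_inv 1 (x \<bullet> (- real (Suc n) *\<^sub>R b) + real (Suc n) * (u \<bullet> b))) \<in> bump_algebra" for b
    by (intro bump_algebra.intros)
  then have "(\<lambda>x. \<Prod>b\<in>Basis. exp_inv 1 (x \<bullet> (real (Suc n) *\<^sub>R b) + - real (Suc n) * (l \<bullet> b)) *
      exp_inv 1 (x \<bullet> (- real (Suc n) *\<^sub>R b) + real (Suc n) * (u \<bullet> b))) \<in> bump_algebra"
    by (rule bump_algebra_prod)
  also have "(\<lambda>x. \<Prod>b\<in>Basis. exp_inv 1 (x \<bullet> (real (Suc n) *\<^sub>R b) + - real (Suc n) * (l \<bullet> b)) *
      exp_inv 1 (x \<bullet> (- real (Suc n) *\<^sub>R b) + real (Suc n) * (u \<bullet> b))) = box_bump n l u"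
    by (auto simp: box_bump_def fun_eq_iff algebra_simps)
  finally have "smooth_fun (box_bump n l u)"
    by (rule bump_algebra_smooth)
  moreover have "compact (closure {x. box_bump n l u x \<noteq> 0})"
  proof -
    have "{x. box_bump n l u x \<noteq> 0} \<subseteq> cbox l u"
      by (force simp: box_bump_def exp_inv_def mem_box zero_less_mult_iff split: if_splits)
    then show ?thesis
      using bounded_cbox bounded_subset compact_closure by blast
  qed
  ultimately show ?thesis by (simp add: test_fun_def)
qed

lemma exp_inv_1_bounds: "0 \<le> exp_inv 1 t" "exp_inv 1 t \<le> 1"
  by (auto simp: exp_inv_def)

lemma box_bump_bounds: "0 \<le> box_bump n l u x" "box_bump n l u x \<le> indicator (cbox l u) x"
proof -
  show "0 \<le> box_bump n l u x"
    unfolding box_bump_def by (intro prod_nonneg mult_nonneg_nonneg exp_inv_1_bounds ballI)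
  have "box_bump n l u x \<le> 1"
    unfolding box_bump_def by (intro prod_le_1 conjI mult_nonneg_nonneg mult_le_one exp_inv_1_bounds)
  moreover have "box_bump n l u x = 0" if nin: "x \<notin> cbox l u"
  proof -
    obtain b where "b \<in> Basis" "x \<bullet> b < l \<bullet> b \<or> u \<bullet> b < x \<bullet> b"
      using nin unfolding mem_box by (meson not_le)
    then show ?thesis
      unfolding box_bump_def by (intro prod_zero bexI[of _ b]) (auto simp: exp_inv_def zero_less_mult_iff)
  qed
  ultimately show "box_bump n l u x \<le> indicator (cbox l u) x"
    by (auto simp: indicator_def)
qed

lemma box_bump_tendsto: "(\<lambda>n. box_bump n l u x) \<longlonglongrightarrow> indicator (box l u) x"
proof -
  have *: "(\<lambda>n. exp_inv 1 (real (Suc n) * t)) \<longlonglongrightarrow> (if 0 < t then 1 else 0)" for t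
  proof (cases "0 < t")
    case True
    have "(\<lambda>n. - inverse t * inverse (real (Suc n))) \<longlonglongrightarrow> - inverse t * 0"
      by (intro tendsto_intros LIMSEQ_inverse_real_of_nat)
    then have "(\<lambda>n. exp (- inverse t * inverse (real (Suc n)))) \<longlonglongrightarrow> exp (- inverse t * 0)"
      by (rule tendsto_exp)
    then show ?thesis
      using True by (simp add: exp_inv_def divide_inverse mult.commute del: of_nat_Suc)
  qed (auto simp: exp_inv_def zero_less_mult_iff)
  have "(\<lambda>n. box_bump n l u x) \<longlonglongrightarrow> (\<Prod>b\<in>Basis. (if 0 < x \<bullet> b - l \<bullet> b then 1 else 0) * (if 0 < u \<bullet> b - x \<bullet> b then 1 else 0))"
    unfolding box_bump_def by (intro tendsto_intros *)
  also have "(\<Prod>b\<in>Basis. (if 0 < x \<bullet> b - l \<bullet> b then 1 else 0) * (if 0 < u \<bullet> b - x \<bullet> b then 1 else 0)) = (indicator (box l u) x :: real)"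
    by (auto simp: indicator_def mem_box)
  finally show ?thesis .
qed

text \<open>The positive and negative parts of h are densities of two measures that agree on open
  boxes. These form an intersection-stable generator with finite measure on growing boxes, so the
  measures coincide, and so do their densities almost everywhere.\<close>

lemma AE_zero_if_box_integrals_zero:
  fixes h :: "'a::euclidean_space \<Rightarrow> real"
  assumes "h \<in> borel_measurable borel"
    and "\<And>l u. integrable lborel (\<lambda>x. h x * indicator (box l u) x)"
    and "\<And>l u. (\<integral>x. h x * indicator (box l u) x \<partial>lborel) = 0"
  shows "AE x in lborel. h x = 0"
proof -
  note [measurable] = assms(1)
  have em: "emeasure (density lborel (\<lambda>x. ennreal (k x))) (box l u) = (\<integral>\<^sup>+x. ennreal (k x * indicator (box l u) x) \<partial>lborel)"
    if [measurable]: "k \<in> borel_measurable borel" for k :: "'a \<Rightarrow> real" and l u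
    by (subst emeasure_density) (auto intro!: nn_integral_cong simp: indicator_def)
  have fin: "integrable lborel (\<lambda>x. max 0 (h x) * indicator (box l u) x)"
    "integrable lborel (\<lambda>x. max 0 (- h x) * indicator (box l u) x)" for l u
    by (rule Bochner_Integration.integrable_bound[OF assms(2)[of l u]]; auto simp: indicator_def)+
  have "density lborel (\<lambda>x. ennreal (max 0 (h x))) = density lborel (\<lambda>x. ennreal (max 0 (- h x)))"
  proof (rule measure_eqI_generator_eq[where E="range (\<lambda>(a, b). box a b)" and \<Omega>=UNIV
        and A="\<lambda>n::nat. box (- real n *\<^sub>R One) (real n *\<^sub>R One)"])
    show "Int_stable (range (\<lambda>(a, b). box a b :: 'a set))"
      by (auto simp: Int_stable_def box_Int_box)
    show "sets (density lborel (\<lambda>x. ennreal (max 0 (h x)))) = sigma_sets UNIV (range (\<lambda>(a, b). box a b))"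
      "sets (density lborel (\<lambda>x. ennreal (max 0 (- h x)))) = sigma_sets UNIV (range (\<lambda>(a, b). box a b))"
      by (simp_all add: borel_eq_box)
    show "(\<Union>n::nat. box (- real n *\<^sub>R One) (real n *\<^sub>R One :: 'a)) = UNIV"
      using UN_box_eq_UNIV by simp
    show "emeasure (density lborel (\<lambda>x. ennreal (max 0 (h x)))) (box (- real n *\<^sub>R One) (real n *\<^sub>R One)) \<noteq> \<infinity>" for n :: nat
      using nn_integral_eq_integral[OF fin(1)] by (subst em) auto
    fix X :: "'a set"
    assume "X \<in> range (\<lambda>(a, b). box a b)"
    then obtain l u where X: "X = box l u" by auto
    have "(\<integral>x. max 0 (h x) * indicator (box l u) x - max 0 (- h x) * indicator (box l u) x \<partial>lborel)
        = (\<integral>x. h x * indicator (box l u) x \<partial>lborel)"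
      by (intro Bochner_Integration.integral_cong) (auto simp: indicator_def max_def)
    then have "(\<integral>x. max 0 (h x) * indicator (box l u) x \<partial>lborel) = (\<integral>x. max 0 (- h x) * indicator (box l u) x \<partial>lborel)"
      using fin[of l u] assms(3)[of l u] by simp
    then have "(\<integral>\<^sup>+x. ennreal (max 0 (h x) * indicator (box l u) x) \<partial>lborel) = (\<integral>\<^sup>+x. ennreal (max 0 (- h x) * indicator (box l u) x) \<partial>lborel)"
      by (subst (1 2) nn_integral_eq_integral) (auto intro: fin)
    then show "emeasure (density lborel (\<lambda>x. ennreal (max 0 (h x)))) X = emeasure (density lborel (\<lambda>x. ennreal (max 0 (- h x)))) X"
      unfolding X by (subst (1 2) em) auto
  qed auto
  then have "AE x in lborel. ennreal (max 0 (h x)) = ennreal (max 0 (- h x))"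
    by (rule sigma_finite_measure.density_unique[OF sigma_finite_lborel, rotated 2]) auto
  then show ?thesis
    by eventually_elim (auto simp: max_def split: if_splits)
qed

text \<open>The bumps converge pointwise to the indicator of the open box and are supported in the
  closed one, where h is integrable by Cauchy-Schwarz; dominated convergence yields vanishing
  integrals over all boxes.\<close>

lemma AE_zero_if_orthogonal_test_fun:
  fixes h :: "'a::euclidean_space \<Rightarrow> real"
  assumes "L2 lebesgue h" "\<And>\<phi>. test_fun UNIV \<phi> \<Longrightarrow> (\<integral>x. h x * \<phi> x \<partial>lebesgue) = 0"
  shows "AE x in lebesgue. h x = 0"
proof -
  obtain h' where m [measurable]: "h' \<in> borel_measurable borel" and ae: "AE x in lborel. h x = h' x"
    using completion_ex_borel_measurable_real[OF L2_measurable[OF assms(1)]] by auto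
  have ae': "AE x in lebesgue. h x = h' x"
    using ae by (rule AE_completion)
  have "L2 lebesgue h'"
    by (rule L2_cong_AE[OF assms(1) _ ae']) (use m in \<open>simp add: measurable_completion\<close>)
  then have L: "L2 lborel h'"
    using m by (auto simp: L2_def integrable_completion)
  have ort: "(\<integral>x. h' x * \<phi> x \<partial>lborel) = 0" if "test_fun UNIV \<phi>" for \<phi>
  proof -
    have [measurable]: "\<phi> \<in> borel_measurable borel"
      using L2_measurable[OF test_fun_L2[OF that]] by simp
    have "(\<integral>x. h' x * \<phi> x \<partial>lborel) = (\<integral>x. h' x * \<phi> x \<partial>lebesgue)"
      by (intro integral_completion[symmetric]) simp
    also have "\<dots> = (\<integral>x. h x * \<phi> x \<partial>lebesgue)"
      using ae' L2_measurable[OF assms(1)]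
      by (intro integral_cong_AE borel_measurable_times) (auto simp: measurable_completion)
    finally show ?thesis using assms(2)[OF that] by simp
  qed
  have cb: "integrable lborel (\<lambda>x. h' x * indicator (cbox l u) x)" for l u
  proof -
    have "L2 lborel (indicator (cbox l u) :: 'a \<Rightarrow> real)"
      using emeasure_lborel_cbox_finite[of l u] by (auto simp: L2_def indicator_power)
    from L2_integrable_inner[OF L this] show ?thesis by simp
  qed
  have bx: "integrable lborel (\<lambda>x. h' x * indicator (box l u) x)" for l u
    by (rule Bochner_Integration.integrable_bound[OF cb[of l u]])
      (use box_subset_cbox[of l u] in \<open>auto simp: indicator_def\<close>)
  have "(\<integral>x. h' x * indicator (box l u) x \<partial>lborel) = 0" for l u
  proof (rule LIMSEQ_unique)
    show "(\<lambda>n. \<integral>x. h' x * box_bump n l u x \<partial>lborel) \<longlonglongrightarrow> (\<integral>x. h' x * indicator (box l u) x \<partial>lborel)"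
    proof (rule integral_dominated_convergence)
      show "integrable lborel (\<lambda>x. \<bar>h' x * indicator (cbox l u) x\<bar>)"
        using cb by (rule integrable_abs)
      show "(\<lambda>x. h' x * box_bump n l u x) \<in> borel_measurable lborel" for n
        using L2_measurable[OF test_fun_L2[OF box_bump_test_fun[of n l u]]] by simp
      show "AE x in lborel. (\<lambda>n. h' x * box_bump n l u x) \<longlonglongrightarrow> h' x * indicator (box l u) x"
        by (intro AE_I2 tendsto_intros box_bump_tendsto)
      show "AE x in lborel. norm (h' x * box_bump n l u x) \<le> \<bar>h' x * indicator (cbox l u) x\<bar>" for n
        using box_bump_bounds[of n l u] by (auto simp: abs_mult intro!: mult_left_mono)
    qed simp
    show "(\<lambda>n. \<integral>x. h' x * box_bump n l u x \<partial>lborel) \<longlonglongrightarrow> 0"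
      by (simp add: ort box_bump_test_fun)
  qed
  from AE_zero_if_box_integrals_zero[OF m bx this] have "AE x in lborel. h' x = 0" .
  with ae have "AE x in lborel. h x = 0"
    by eventually_elim simp
  then show ?thesis by (rule AE_completion)
qed

section \<open>Uniqueness and linearity of weak gradients\<close>

lemma L2_inner_Basis:
  assumes "L2 M f" "b \<in> Basis"
  shows "L2 M (\<lambda>x. f x \<bullet> b)"
proof -
  have [measurable]: "f \<in> borel_measurable M" using assms(1) by (rule L2_measurable)
  have "integrable M (\<lambda>x. (norm (f x \<bullet> b))\<^sup>2)"
  proof (rule Bochner_Integration.integrable_bound[OF L2_integrable_sq[OF assms(1)]])
    have "(f x \<bullet> b)\<^sup>2 \<le> (norm (f x))\<^sup>2" for x
      using Basis_le_norm[OF assms(2), of "f x"] by (simp add: abs_le_square_iff[symmetric])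
    then show "AE x in M. norm ((norm (f x \<bullet> b))\<^sup>2) \<le> norm ((norm (f x))\<^sup>2)"
      by simp
  qed measurable
  then show ?thesis by (simp add: L2_def)
qed

text \<open>Each component of g - g' is orthogonal to all test functions. Square integrability is
  what allows subtracting the two defining integrals.\<close>

lemma weak_grad_unique:
  fixes u :: "'a::euclidean_space \<Rightarrow> real"
  assumes "weak_grad u g" "weak_grad u g'" "L2 lebesgue g" "L2 lebesgue g'"
  shows "AE x in lebesgue. g x = g' x"
proof -
  have "AE x in lebesgue. (g x - g' x) \<bullet> b = 0" if b: "b \<in> Basis" for b
  proof (rule AE_zero_if_orthogonal_test_fun)
    have L: "L2 lebesgue (\<lambda>x. f x \<bullet> b)" if "L2 lebesgue f" for f :: "'a \<Rightarrow> 'a"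
      using that b by (rule L2_inner_Basis)
    show "L2 lebesgue (\<lambda>x. (g x - g' x) \<bullet> b)"
      by (intro L L2_diff assms)
    fix \<phi> :: "'a \<Rightarrow> real"
    assume \<phi>: "test_fun UNIV \<phi>"
    have "integrable lebesgue (\<lambda>x. (f x \<bullet> b) * \<phi> x)" if "L2 lebesgue f" for f :: "'a \<Rightarrow> 'a"
      using L2_integrable_inner[OF L[OF that] L2_lebesgue[OF test_fun_L2[OF \<phi>]]] by simp
    moreover have "(\<integral>x. (f x \<bullet> b) * \<phi> x \<partial>lebesgue) = - (\<integral>x. u x * partial b \<phi> x \<partial>lebesgue)"
      if "weak_grad u f" for f
      using that \<phi> b by (simp add: weak_grad_def)
    ultimately show "(\<integral>x. (g x - g' x) \<bullet> b * \<phi> x \<partial>lebesgue) = 0"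
      using assms by (simp add: inner_diff_left left_diff_distrib)
  qed
  then have "AE x in lebesgue. \<forall>b\<in>Basis. (g x - g' x) \<bullet> b = 0"
    by (simp add: AE_finite_all)
  then show ?thesis
  proof eventually_elim
    case (elim x)
    show ?case by (rule euclidean_eqI) (use elim in \<open>simp add: inner_diff_left\<close>)
  qed
qed

lemma weak_grad_lincomb:
  fixes u v :: "'a::euclidean_space \<Rightarrow> real"
  assumes "weak_grad u g" "weak_grad v h" "L2 lebesgue u" "L2 lebesgue v" "L2 lebesgue g" "L2 lebesgue h"
  shows "weak_grad (\<lambda>x. \<alpha> * u x + \<beta> * v x) (\<lambda>x. \<alpha> *\<^sub>R g x + \<beta> *\<^sub>R h x)"
  unfolding weak_grad_def
proof (intro conjI allI impI)
  show "(\<lambda>x. \<alpha> *\<^sub>R g x + \<beta> *\<^sub>R h x) \<in> borel_measurable lebesgue"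
    by (intro L2_measurable L2_lincomb assms)
  fix \<phi> :: "'a \<Rightarrow> real" and b :: 'a
  assume "test_fun UNIV \<phi> \<and> b \<in> Basis"
  then have \<phi>: "test_fun UNIV \<phi>" and b: "b \<in> Basis" by auto
  have "partial b \<phi> x = cgrad \<phi> x \<bullet> b" for x
    using b by (simp add: cgrad_def inner_sum_left inner_Basis if_distrib cong: if_cong)
  then have L: "L2 lebesgue (partial b \<phi>)"
    using L2_inner_Basis[OF L2_lebesgue[OF test_fun_L2_cgrad[OF \<phi>]] b] by presburger
  have iu: "integrable lebesgue (\<lambda>x. f x * partial b \<phi> x)" if "L2 lebesgue f" for f :: "'a \<Rightarrow> real"
    using L2_integrable_inner[OF that L] by simp
  have ig: "integrable lebesgue (\<lambda>x. (f x \<bullet> b) * \<phi> x)" if "L2 lebesgue f" for f :: "'a \<Rightarrow> 'a"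
    using L2_integrable_inner[OF L2_inner_Basis[OF that b] L2_lebesgue[OF test_fun_L2[OF \<phi>]]] by simp
  have wg: "(\<integral>x. u x * partial b \<phi> x \<partial>lebesgue) = - (\<integral>x. (g x \<bullet> b) * \<phi> x \<partial>lebesgue)"
    if "weak_grad u g" for u g
    using that \<phi> b by (simp add: weak_grad_def)
  have "(\<integral>x. (\<alpha> * u x + \<beta> * v x) * partial b \<phi> x \<partial>lebesgue)
      = \<alpha> * (\<integral>x. u x * partial b \<phi> x \<partial>lebesgue) + \<beta> * (\<integral>x. v x * partial b \<phi> x \<partial>lebesgue)"
    using iu[OF assms(3)] iu[OF assms(4)] by (simp add: distrib_right mult.assoc)
  also have "\<dots> = - (\<alpha> * (\<integral>x. (g x \<bullet> b) * \<phi> x \<partial>lebesgue) + \<beta> * (\<integral>x. (h x \<bullet> b) * \<phi> x \<partial>lebesgue))"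
    by (simp add: wg[OF assms(1)] wg[OF assms(2)])
  also have "\<dots> = - (\<integral>x. ((\<alpha> *\<^sub>R g x + \<beta> *\<^sub>R h x) \<bullet> b) * \<phi> x \<partial>lebesgue)"
    using ig[OF assms(5)] ig[OF assms(6)] by (simp add: inner_add_left distrib_right mult.assoc)
  finally show "(\<integral>x. (\<alpha> * u x + \<beta> * v x) * partial b \<phi> x \<partial>lebesgue)
      = - (\<integral>x. ((\<alpha> *\<^sub>R g x + \<beta> *\<^sub>R h x) \<bullet> b) * \<phi> x \<partial>lebesgue)" .
qed

text \<open>Lets any square-integrable weak gradient at hand replace the chosen one in
  \<open>dirichlet\<close> and \<open>eigenfunction\<close>.\<close>

lemma wgrad_AE_eq:
  assumes "weak_grad u g" "L2 lebesgue g"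
  shows "wgrad u \<in> borel_measurable lebesgue" "AE x in lebesgue. wgrad u x = g x"
proof -
  have "weak_grad u g \<and> integrable lebesgue (\<lambda>x. (norm (g x))\<^sup>2)"
    using assms by (simp add: L2_def)
  then have "weak_grad u (wgrad u) \<and> integrable lebesgue (\<lambda>x. (norm (wgrad u x))\<^sup>2)"
    unfolding wgrad_def
    by (rule someI[where P="\<lambda>g. weak_grad u g \<and> integrable lebesgue (\<lambda>x. (norm (g x))\<^sup>2)"])
  then have *: "weak_grad u (wgrad u)" "integrable lebesgue (\<lambda>x. (norm (wgrad u x))\<^sup>2)"
    by auto
  then show m: "wgrad u \<in> borel_measurable lebesgue"
    by (simp add: weak_grad_def)
  show "AE x in lebesgue. wgrad u x = g x"
    by (rule weak_grad_unique[OF *(1) assms(1) _ assms(2)]) (use * m in \<open>simp add: L2_def\<close>)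
qed

section \<open>Eigenvalues of a disjoint union\<close>


text \<open>The gradient vanishes almost everywhere outside U, so the energy does not depend on the
  domain over which it is taken.\<close>

lemma dirichlet_eq_nsq:
  assumes "weak_grad u g" "H1_limit U u g" "open U"
  shows "dirichlet U u = nsq lebesgue g"
proof -
  have U: "U \<in> sets lebesgue" using assms(3) by auto
  note wg = wgrad_AE_eq[OF assms(1) H1_limit_L2_grad[OF assms(2)]]
  have [measurable]: "wgrad u \<in> borel_measurable lebesgue" "g \<in> borel_measurable lebesgue"
    using wg(1) L2_measurable[OF H1_limit_L2_grad[OF assms(2)]] by auto
  show ?thesis
    unfolding dirichlet_def set_lebesgue_integral_def nsq_def
  proof (rule integral_cong_AE)
    show "AE x in lebesgue. indicator U x *\<^sub>R (norm (wgrad u x))\<^sup>2 = (norm (g x))\<^sup>2"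
      using wg(2) H1_limit_zero_outside(2)[OF assms(2) U]
      by eventually_elim (auto simp: indicator_def)
  qed (use U in measurable)
qed

lemma AE_not_in_open_imp_empty:
  assumes "open U" "AE x in lebesgue. x \<notin> U"
  shows "U = {}"
proof -
  have "U \<in> null_sets lebesgue"
    using assms by (subst AE_iff_null_sets) auto
  then have "negligible U" by (simp add: negligible_iff_null_sets)
  then show ?thesis using assms(1) open_not_negligible by blast
qed

text \<open>Strictness comes from U x V, where the negated integrand F is positive. If F vanished
  almost everywhere, Fubini would make one of the nonempty open sets U, V null.\<close>

lemma frac_form_disjoint_neg:
  fixes u v :: "'a::euclidean_space \<Rightarrow> real"
  assumes u: "H1_limit U u g" "open U" "U \<noteq> {}" "\<forall>x\<in>U. 0 < u x"
    and v: "H1_limit V v h" "open V" "V \<noteq> {}" "\<forall>x\<in>V. 0 < v x"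
    and disj: "U \<inter> V = {}" and s: "0 < s" "s < 1"
  shows "frac_form s u v < 0"
proof -
  let ?M = "lebesgue \<Otimes>\<^sub>M lebesgue :: ('a \<times> 'a) measure"
  define F where "F q = - (diff_quot s u q * diff_quot s v q)" for q
  let ?d = "\<lambda>x y :: 'a. norm (x - y) powr ((real DIM('a) + 2 * s) / 2)"
  have F: "F (x, y) = - ((u x - u y) * (v x - v y)) / (?d x y * ?d x y)" for x y
    by (simp add: F_def diff_quot_def)
  have int: "integrable ?M F"
    using L2_integrable_inner[OF diff_quot_L2(1)[OF u(1) s] diff_quot_L2(1)[OF v(1) s]]
    by (simp add: F_def[abs_def])
  define P where "P x \<longleftrightarrow> (x \<notin> U \<longrightarrow> u x = 0) \<and> (x \<notin> V \<longrightarrow> v x = 0)" for x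
  have P: "AE x in lebesgue. P x"
    using H1_limit_zero_outside(1)[OF u(1)] H1_limit_zero_outside(1)[OF v(1)] u(2) v(2) by (simp add: P_def)
  have P': "0 \<le> u x" "0 \<le> v x" "u x * v x = 0" if "P x" for x
    using that u(4) v(4) disj less_imp_le[of 0 "u x"] less_imp_le[of 0 "v x"] by (auto simp: P_def)
  have F': "F (x, y) = (u x * v y + u y * v x) / (?d x y * ?d x y)" if "P x" "P y" for x y
  proof -
    have "- ((u x - u y) * (v x - v y)) = (u x * v y + u y * v x) - u x * v x - u y * v y"
      by (simp add: algebra_simps)
    then show ?thesis
      unfolding F P'(3)[OF that(1)] P'(3)[OF that(2)] by simp
  qed
  have meas: "F \<in> borel_measurable ?M"
    using int by (rule borel_measurable_integrable)
  have "AE q in ?M. 0 \<le> F q"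
  proof (rule lebesgue_pair.AE_pair_measure)
    show "{q \<in> space ?M. 0 \<le> F q} \<in> sets ?M"
      using meas by measurable
    show "AE x in lebesgue. AE y in lebesgue. 0 \<le> F (x, y)"
      using P
    proof eventually_elim
      case x: (elim x)
      show ?case
        using P
      proof eventually_elim
        case (elim y)
        show ?case
          unfolding F'[OF x elim] using P'[OF x] P'[OF elim] by (intro divide_nonneg_nonneg add_nonneg_nonneg mult_nonneg_nonneg) auto
      qed
    qed
  qed
  moreover have "\<not> (AE q in ?M. F q = 0)"
  proof
    assume "AE q in ?M. F q = 0"
    then have "AE x in lebesgue. AE y in lebesgue. F (x, y) = 0"
      by (rule lebesgue_pair.AE_pair)
    with P have "AE x in lebesgue. x \<notin> U"
    proof eventually_elim
      case (elim x)
      show ?case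
      proof
        assume x: "x \<in> U"
        have "AE y in lebesgue. y \<notin> V"
          using P elim(2)
        proof eventually_elim
          case y: (elim y)
          show ?case
          proof
            assume yV: "y \<in> V"
            have "x \<noteq> y" using x yV disj by auto
            then have "0 < ?d x y * ?d x y" by simp
            moreover have "0 < u x * v y" using x yV u(4) v(4) by simp
            moreover have "0 \<le> u y * v x" using P'[OF elim(1)] P'[OF y(1)] by simp
            ultimately have "0 < F (x, y)"
              unfolding F'[OF elim(1) y(1)] by (intro divide_pos_pos add_pos_nonneg)
            then show False using y(2) by simp
          qed
        qed
        then show False using AE_not_in_open_imp_empty v(2,3) by blast
      qed
    qed
    then show False using AE_not_in_open_imp_empty u(2,3) by blast
  qed
  ultimately have "0 < integral\<^sup>L ?M F"
    using integral_nonneg_eq_0_iff_AE[OF int] integral_nonneg_AE[of F ?M] by (auto simp: order_less_le)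
  moreover have "ip ?M (diff_quot s u) (diff_quot s v) = - integral\<^sup>L ?M F"
    by (simp add: ip_def F_def[abs_def])
  ultimately show ?thesis
    using s cNs_pos[of s "DIM('a)"] by (simp add: frac_form_eq_ip mult_pos_neg)
qed

section \<open>The weak equation and the comparison of eigenvalues\<close>

context interval_measure
begin

text \<open>At s = 0 the form is the integral of u v, hence 0. The strict sign comes from (0,1),
  which carries mass.\<close>

lemma mu_form_disjoint_neg:
  fixes u v :: "'a::euclidean_space \<Rightarrow> real"
  assumes u: "H1_limit U u g" "open U" "U \<noteq> {}" "\<forall>x\<in>U. 0 < u x"
    and v: "H1_limit V v h" "open V" "V \<noteq> {}" "\<forall>x\<in>V. 0 < v x"
    and disj: "U \<inter> V = {}" and \<mu>: "emeasure \<mu> {0<..<1} \<noteq> 0"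
  shows "mu_form \<mu> u v < 0"
proof -
  let ?f = "\<lambda>s. - (indicator {0..<1} s * frac_form s u v)"
  have neg: "frac_form s u v < 0" if "0 < s" "s < 1" for s
    using frac_form_disjoint_neg[OF u v disj that] .
  have zero: "frac_form 0 u v = 0"
  proof -
    have "AE x in lebesgue. u x * v x = 0"
      using H1_limit_zero_outside(1)[OF u(1)] H1_limit_zero_outside(1)[OF v(1)] u(2) v(2)
      by (auto elim!: eventually_elim2 simp: disj[unfolded disjoint_iff])
    then show ?thesis by (simp add: frac_form_def integral_eq_zero_AE)
  qed
  have nonneg: "0 \<le> ?f s" for s
    using neg[of s] zero by (cases "s = 0") (auto simp: indicator_def)
  have int: "integrable \<mu> ?f"
    using frac_form_integrable[OF u(1) v(1)] by simp
  have "integral\<^sup>L \<mu> ?f \<noteq> 0"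
  proof
    assume "integral\<^sup>L \<mu> ?f = 0"
    then have "AE s in \<mu>. ?f s = 0"
      using integral_nonneg_eq_0_iff_AE[OF int] nonneg by auto
    then have "AE s in \<mu>. s \<notin> {0<..<1}"
      by eventually_elim (use neg in \<open>force simp: indicator_def split: if_splits\<close>)
    \<comment> \<open>A set that is not measurable has \<open>emeasure\<close> 0, so nonzero mass
      already implies measurability.\<close>
    moreover have "{0<..<1} \<in> sets \<mu>"
      using \<mu> emeasure_notin_sets by blast
    ultimately show False
      using \<mu> AE_iff_null_sets[of "{0<..<1}" \<mu>] by auto
  qed
  moreover have "0 \<le> integral\<^sup>L \<mu> ?f"
    using nonneg by (simp add: integral_nonneg_AE del: integral_minus)
  ultimately show ?thesis
    by (simp add: mu_form_eq)
qed

text \<open>Extends the weak equation from test functions to H^1 limits, as both sides are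
  continuous. The smaller domain V allows testing an equation on the union with a function living on
  one component.\<close>

lemma eigenfunction_test:
  fixes u v :: "'a::euclidean_space \<Rightarrow> real"
  assumes "eigenfunction U \<mu> lm u" "weak_grad u g" "H1_limit U u g" "H1_limit V v h" "V \<subseteq> U" "open U"
  shows "ip lebesgue g h = lm * mu_form \<mu> u v"
proof -
  have U: "U \<in> sets lebesgue" using assms(6) by auto
  obtain \<phi> where \<phi>: "\<And>k. test_fun V (\<phi> k)"
    "(\<lambda>k. nsq lebesgue (\<lambda>x. \<phi> k x - v x)) \<longlonglongrightarrow> 0"
    "(\<lambda>k. nsq lebesgue (\<lambda>x. cgrad (\<phi> k) x - h x)) \<longlonglongrightarrow> 0"
    using H1_limitE[OF assms(4)] by blast
  note g = H1_limit_L2_grad[OF assms(3)]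
  note wg = wgrad_AE_eq[OF assms(2) g]
  have L: "L2 lebesgue (cgrad (\<phi> k))" for k
    by (rule L2_lebesgue[OF test_fun_L2_cgrad[OF \<phi>(1)]])
  have eq: "ip lebesgue g (cgrad (\<phi> k)) = lm * mu_form \<mu> u (\<phi> k)" for k
  proof -
    have t: "test_fun U (\<phi> k)" using test_fun_mono[OF \<phi>(1) assms(5)] .
    have [measurable]: "wgrad u \<in> borel_measurable lebesgue" "g \<in> borel_measurable lebesgue"
      "cgrad (\<phi> k) \<in> borel_measurable lebesgue"
      using wg(1) L2_measurable[OF g] L2_measurable[OF L] by auto
    have "ip lebesgue g (cgrad (\<phi> k)) = (LINT x:U|lebesgue. wgrad u x \<bullet> cgrad (\<phi> k) x)"
      unfolding ip_def set_lebesgue_integral_def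
    proof (rule integral_cong_AE)
      show "AE x in lebesgue. g x \<bullet> cgrad (\<phi> k) x = indicator U x *\<^sub>R (wgrad u x \<bullet> cgrad (\<phi> k) x)"
        using wg(2) by eventually_elim (auto simp: indicator_def test_fun_cgrad_zero_outside[OF t])
    qed (use U in measurable)
    then show ?thesis
      using assms(1) t by (simp add: eigenfunction_def)
  qed
  have "(\<lambda>k. ip lebesgue g (cgrad (\<phi> k))) \<longlonglongrightarrow> ip lebesgue g h"
    by (rule ip_tendsto[OF L H1_limit_L2_grad[OF assms(4)] g \<phi>(3)])
  moreover have "(\<lambda>k. ip lebesgue g (cgrad (\<phi> k))) \<longlonglongrightarrow> lm * mu_form \<mu> u v"
    unfolding eq by (intro tendsto_intros mu_form_tendsto[OF assms(3,4) \<phi>])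
  ultimately show ?thesis by (rule LIMSEQ_unique)
qed

text \<open>No quotient is negative, a zero denominator giving 0, so the infimum is taken over a set
  bounded below.\<close>

lemma lam_le:
  assumes "u \<in> H10 U" "nonzero_fun u"
  shows "lam U \<mu> \<le> dirichlet U u / mu_form \<mu> u u"
  unfolding lam_def
proof (rule cInf_lower)
  show "bdd_below {dirichlet U u / mu_form \<mu> u u |u. u \<in> H10 U \<and> nonzero_fun u}"
    by (rule bdd_belowI[of _ 0])
      (auto intro!: divide_nonneg_nonneg mu_form_nonneg simp: dirichlet_def set_lebesgue_integral_def)
qed (use assms in blast)

lemma lam_nonneg:
  assumes "u \<in> H10 U" "nonzero_fun u"
  shows "0 \<le> lam U \<mu>"
  unfolding lam_def
  by (rule cInf_greatest) (use assms in \<open>auto intro!: divide_nonneg_nonneg mu_form_nonneg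
      simp: dirichlet_def set_lebesgue_integral_def\<close>)

text \<open>The identity for \<open>nsq\<close> is the weak equation tested with u itself.\<close>

definition positive_eigenpair :: "'a::euclidean_space set \<Rightarrow> ('a \<Rightarrow> real) \<Rightarrow> ('a \<Rightarrow> 'a) \<Rightarrow> bool" where
  "positive_eigenpair U u g \<longleftrightarrow> open U \<and> U \<noteq> {} \<and> (\<forall>x\<in>U. 0 < u x) \<and> weak_grad u g \<and> H1_limit U u g \<and>
     eigenfunction U \<mu> (lam U \<mu>) u \<and> nsq lebesgue g = lam U \<mu> * mu_form \<mu> u u \<and> 0 < lam U \<mu> \<and> 0 < mu_form \<mu> u u"

text \<open>By \<open>Poincare_zero\<close> a nonzero u has nonzero gradient norm, so the product of
  \<open>lam\<close> and \<open>mu_form\<close> is nonzero; both factors are nonnegative, hence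
  positive.\<close>

lemma positive_eigenpair_exists:
  fixes u :: "'a::euclidean_space \<Rightarrow> real"
  assumes "open U" "bounded U" "\<forall>x\<in>U. 0 < u x" "eigenfunction U \<mu> (lam U \<mu>) u"
  obtains g where "positive_eigenpair U u g"
proof -
  have U: "U \<in> sets lebesgue" using assms(1) by auto
  have u: "u \<in> H10 U" "nonzero_fun u" using assms(4) by (auto simp: eigenfunction_def)
  then obtain g where g: "weak_grad u g" "H1_limit U u g"
    by (auto simp: H10_iff)
  have "U \<noteq> {}"
    using H1_limit_zero_outside(1)[OF g(2) U] u(2) by (auto simp: nonzero_fun_def)
  have eq: "nsq lebesgue g = lam U \<mu> * mu_form \<mu> u u"
    unfolding nsq_ip by (rule eigenfunction_test[OF assms(4) g g(2) order_refl assms(1)])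
  have "nsq lebesgue g \<noteq> 0"
    using Poincare_zero[OF g(2) _ assms(2) U] u(2) by (auto simp: nonzero_fun_def)
  then have "lam U \<mu> \<noteq> 0" "mu_form \<mu> u u \<noteq> 0" using eq by auto
  then have "0 < lam U \<mu>" "0 < mu_form \<mu> u u"
    using lam_nonneg[OF u] mu_form_nonneg[of u] by auto
  then show thesis
    using that[of g] \<open>U \<noteq> {}\<close> assms g eq by (auto simp: positive_eigenpair_def)
qed

lemma ip_grad_disjoint:
  assumes "H1_limit U u g" "H1_limit V v h" "open U" "open V" "U \<inter> V = {}"
  shows "ip lebesgue g h = 0"
proof -
  have "AE x in lebesgue. g x \<bullet> h x = 0"
    using H1_limit_zero_outside(2)[OF assms(1)] H1_limit_zero_outside(2)[OF assms(2)] assms(3,4)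
    by (auto elim!: eventually_elim2 simp: assms(5)[unfolded disjoint_iff])
  then show ?thesis by (simp add: ip_def integral_eq_zero_AE)
qed

lemma lam_union_less:
  fixes u v :: "'a::euclidean_space \<Rightarrow> real"
  assumes pu: "positive_eigenpair U u g" and pv: "positive_eigenpair V v h"
    and disj: "U \<inter> V = {}" and \<mu>: "emeasure \<mu> {0<..<1} \<noteq> 0" and le: "lam U \<mu> \<le> lam V \<mu>"
  shows "lam (U \<union> V) \<mu> < lam U \<mu>"
proof -
  have u: "open U" "U \<noteq> {}" "\<forall>x\<in>U. 0 < u x" "weak_grad u g" "H1_limit U u g"
    "nsq lebesgue g = lam U \<mu> * mu_form \<mu> u u" "0 < lam U \<mu>" "0 < mu_form \<mu> u u"
    using pu by (auto simp: positive_eigenpair_def)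
  have v: "open V" "V \<noteq> {}" "\<forall>x\<in>V. 0 < v x" "weak_grad v h" "H1_limit V v h"
    "nsq lebesgue h = lam V \<mu> * mu_form \<mu> v v" "0 < lam V \<mu>" "0 < mu_form \<mu> v v"
    using pv by (auto simp: positive_eigenpair_def)
  define m where "m = - mu_form \<mu> u v"
  have m: "0 < m"
    using mu_form_disjoint_neg[OF u(5,1,2,3) v(5,1,2,3) disj \<mu>] by (simp add: m_def)
  \<comment> \<open>With the denominator cleared, the desired inequality for u - t v reads t^2 d < 2
    t (\<open>lam U \<mu>\<close> * m).\<close>
  define d where "d = (lam V \<mu> - lam U \<mu>) * mu_form \<mu> v v"
  have d: "0 \<le> d" using le v(8) by (simp add: d_def)
  \<comment> \<open>The equal-eigenvalue case has d = 0; the summand 1 keeps the denominator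
    positive, and t d stays below \<open>lam U \<mu>\<close> * m + 1 scaled out, that is, t (d + 1)
    = \<open>lam U \<mu>\<close> * m.\<close>
  define t where "t = lam U \<mu> * m / (d + 1)"
  have t: "0 < t" using u(7) m d by (simp add: t_def)
  have "t * d < 2 * (lam U \<mu> * m)"
  proof -
    have "t * d \<le> t * (d + 1)" using t by simp
    also have "\<dots> = lam U \<mu> * m" using d by (simp add: t_def)
    also have "\<dots> < 2 * (lam U \<mu> * m)" using u(7) m by simp
    finally show ?thesis .
  qed
  then have td: "t\<^sup>2 * d < 2 * t * (lam U \<mu> * m)"
    using t mult_strict_left_mono[of "t * d" _ t] by (simp add: power2_eq_square algebra_simps)
  let ?w = "\<lambda>x. 1 * u x + (- t) * v x" and ?k = "\<lambda>x. 1 *\<^sub>R g x + (- t) *\<^sub>R h x"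
  have Hu: "H1_limit (U \<union> V) u g" and Hv: "H1_limit (U \<union> V) v h"
    using H1_limit_mono[OF u(5), of "U \<union> V"] H1_limit_mono[OF v(5), of "U \<union> V"] by auto
  have Hw: "H1_limit (U \<union> V) ?w ?k"
    by (rule H1_limit_lincomb[OF Hu Hv])
  have ww: "weak_grad ?w ?k"
    using u(4,5) v(4,5) by (intro weak_grad_lincomb) (auto dest: H1_limit_L2 H1_limit_L2_grad)
  have D: "dirichlet (U \<union> V) ?w = lam U \<mu> * mu_form \<mu> u u + t\<^sup>2 * (lam V \<mu> * mu_form \<mu> v v)"
    unfolding dirichlet_eq_nsq[OF ww Hw open_Un[OF u(1) v(1)]]
    using nsq_lincomb[OF H1_limit_L2_grad[OF u(5)] H1_limit_L2_grad[OF v(5)], of 1 "- t"]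
      ip_grad_disjoint[OF u(5) v(5) u(1) v(1) disj] u(6) v(6) by simp
  have M: "mu_form \<mu> ?w ?w = mu_form \<mu> u u + 2 * t * m + t\<^sup>2 * mu_form \<mu> v v"
    using mu_form_lincomb_self[OF Hu Hv, of 1 "- t"] by (simp add: m_def)
  \<comment> \<open>On U the function v vanishes almost everywhere, so there the competitor is u >
    0.\<close>
  have nz: "nonzero_fun ?w"
    unfolding nonzero_fun_def
  proof
    assume "AE x in lebesgue. ?w x = 0"
    moreover have "AE x in lebesgue. x \<notin> V \<longrightarrow> v x = 0"
      using H1_limit_zero_outside(1)[OF v(5)] v(1) by auto
    ultimately have "AE x in lebesgue. x \<notin> U"
      by eventually_elim (use u(3) disj in fastforce)
    then show False using AE_not_in_open_imp_empty u(1,2) by blast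
  qed
  have "?w \<in> H10 (U \<union> V)"
    using ww Hw unfolding H10_iff by blast
  then have "lam (U \<union> V) \<mu> \<le> dirichlet (U \<union> V) ?w / mu_form \<mu> ?w ?w"
    using nz by (rule lam_le)
  also have "\<dots> < lam U \<mu>"
  proof -
    have "0 < mu_form \<mu> ?w ?w"
      unfolding M using u(8) v(8) m t by (intro add_pos_pos) auto
    moreover have "dirichlet (U \<union> V) ?w < lam U \<mu> * mu_form \<mu> ?w ?w"
      unfolding D M using td by (simp add: d_def algebra_simps)
    ultimately show ?thesis by (simp add: pos_divide_less_eq)
  qed
  finally show ?thesis .
qed

text \<open>Bounds one coefficient only; exchanging the two pairs bounds the other. The gradients of
  u and v are orthogonal, so v enters the tested equation through the nonlocal form alone.\<close>

lemma eigenfunction_union_coeff_nonpos: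
  fixes u v :: "'a::euclidean_space \<Rightarrow> real"
  assumes pu: "positive_eigenpair U u g" and pv: "positive_eigenpair V v h"
    and disj: "U \<inter> V = {}" and \<mu>: "emeasure \<mu> {0<..<1} \<noteq> 0"
    and e: "eigenfunction (U \<union> V) \<mu> lm (\<lambda>x. a * u x + b * v x)"
    and lm: "0 \<le> lm" "lm < lam U \<mu>" and b: "0 \<le> b"
  shows "a \<le> 0"
proof -
  have u: "open U" "U \<noteq> {}" "\<forall>x\<in>U. 0 < u x" "weak_grad u g" "H1_limit U u g"
    "nsq lebesgue g = lam U \<mu> * mu_form \<mu> u u" "0 < lam U \<mu>" "0 < mu_form \<mu> u u"
    using pu by (auto simp: positive_eigenpair_def)
  have v: "open V" "V \<noteq> {}" "\<forall>x\<in>V. 0 < v x" "weak_grad v h" "H1_limit V v h"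
    using pv by (auto simp: positive_eigenpair_def)
  let ?w = "\<lambda>x. a * u x + b * v x" and ?k = "\<lambda>x. a *\<^sub>R g x + b *\<^sub>R h x"
  have Hu: "H1_limit (U \<union> V) u g" and Hv: "H1_limit (U \<union> V) v h"
    using H1_limit_mono[OF u(5), of "U \<union> V"] H1_limit_mono[OF v(5), of "U \<union> V"] by auto
  have Hw: "H1_limit (U \<union> V) ?w ?k"
    by (rule H1_limit_lincomb[OF Hu Hv])
  have ww: "weak_grad ?w ?k"
    using u(4,5) v(4,5) by (intro weak_grad_lincomb) (auto dest: H1_limit_L2 H1_limit_L2_grad)
  have "ip lebesgue ?k g = lm * mu_form \<mu> ?w u"
    by (rule eigenfunction_test[OF e ww Hw u(5)]) (use u(1) v(1) in auto)
  moreover have "ip lebesgue ?k g = a * (lam U \<mu> * mu_form \<mu> u u)"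
    using ip_lincomb_right[OF H1_limit_L2_grad[OF u(5)] H1_limit_L2_grad[OF v(5)] H1_limit_L2_grad[OF u(5)], of a b]
      ip_grad_disjoint[OF u(5) v(5) u(1) v(1) disj] u(6)
    by (simp add: ip_commute nsq_ip)
  moreover have "mu_form \<mu> ?w u = a * mu_form \<mu> u u + b * mu_form \<mu> u v"
    using mu_form_lincomb_left[OF u(5) v(5) u(5), of a b] by (simp add: mu_form_commute[of v u])
  ultimately have "a * ((lam U \<mu> - lm) * mu_form \<mu> u u) = (lm * b) * mu_form \<mu> u v"
    by (simp add: algebra_simps)
  also have "\<dots> \<le> 0"
    using mu_form_disjoint_neg[OF u(5,1,2,3) v(5,1,2,3) disj \<mu>] lm(1) b
    by (intro mult_nonneg_nonpos mult_nonneg_nonneg) auto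
  finally show ?thesis
    using lm(2) u(8) by (simp add: mult_le_0_iff not_less)
qed

end

theorem theorem1p5:
  fixes \<Omega>1 \<Omega>2 :: "'a::euclidean_space set"
    and \<mu> :: "real measure"
    and u1 u2 :: "'a \<Rightarrow> real"
  assumes "bounded \<Omega>1" "connected \<Omega>1" "open \<Omega>1" "C1_boundary \<Omega>1"
    and "bounded \<Omega>2" "connected \<Omega>2" "open \<Omega>2" "C1_boundary \<Omega>2"
    and "closure \<Omega>1 \<inter> closure \<Omega>2 = {}"
    and "finite_measure \<mu>" "sets \<mu> = sets (restrict_space borel {0..1::real})"
    and "emeasure \<mu> {0<..<1} \<noteq> 0"
    and "eigenfunction \<Omega>1 \<mu> (lam \<Omega>1 \<mu>) u1" "\<forall>x\<in>\<Omega>1. u1 x > 0"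
    and "eigenfunction \<Omega>2 \<mu> (lam \<Omega>2 \<mu>) u2" "\<forall>x\<in>\<Omega>2. u2 x > 0"
  shows "lam (\<Omega>1 \<union> \<Omega>2) \<mu> < min (lam \<Omega>1 \<mu>) (lam \<Omega>2 \<mu>) \<and>
    (\<forall>c1 c2. c1 \<ge> 0 \<and> c2 \<ge> 0 \<longrightarrow>
       \<not> eigenfunction (\<Omega>1 \<union> \<Omega>2) \<mu> (lam (\<Omega>1 \<union> \<Omega>2) \<mu>) (\<lambda>x. c1 * u1 x + c2 * u2 x))"
proof -
  interpret interval_measure \<mu>
    using assms(10,11) by (simp add: interval_measure_def interval_measure_axioms_def)
  have disj: "\<Omega>1 \<inter> \<Omega>2 = {}" "\<Omega>2 \<inter> \<Omega>1 = {}"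
    using assms(9) closure_subset by blast+
  obtain g1 where p1: "positive_eigenpair \<Omega>1 u1 g1"
    using positive_eigenpair_exists[OF assms(3,1,14,13)] by blast
  obtain g2 where p2: "positive_eigenpair \<Omega>2 u2 g2"
    using positive_eigenpair_exists[OF assms(7,5,16,15)] by blast
  have less: "lam (\<Omega>1 \<union> \<Omega>2) \<mu> < min (lam \<Omega>1 \<mu>) (lam \<Omega>2 \<mu>)"
  proof (cases "lam \<Omega>1 \<mu> \<le> lam \<Omega>2 \<mu>")
    case True
    then show ?thesis
      using lam_union_less[OF p1 p2 disj(1) assms(12)] by simp
  next
    case False
    then show ?thesis
      using lam_union_less[OF p2 p1 disj(2) assms(12)] by (simp add: Un_commute)
  qed
  moreover have "\<not> eigenfunction (\<Omega>1 \<union> \<Omega>2) \<mu> (lam (\<Omega>1 \<union> \<Omega>2) \<mu>) (\<lambda>x. c1 * u1 x + c2 * u2 x)"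
    if c: "0 \<le> c1" "0 \<le> c2" for c1 c2
  proof
    assume e: "eigenfunction (\<Omega>1 \<union> \<Omega>2) \<mu> (lam (\<Omega>1 \<union> \<Omega>2) \<mu>) (\<lambda>x. c1 * u1 x + c2 * u2 x)"
    then have e': "eigenfunction (\<Omega>2 \<union> \<Omega>1) \<mu> (lam (\<Omega>1 \<union> \<Omega>2) \<mu>) (\<lambda>x. c2 * u2 x + c1 * u1 x)"
      by (simp add: Un_commute add.commute)
    have nonneg: "0 \<le> lam (\<Omega>1 \<union> \<Omega>2) \<mu>"
      using e by (intro lam_nonneg) (auto simp: eigenfunction_def)
    have "c1 \<le> 0"
      by (rule eigenfunction_union_coeff_nonpos[OF p1 p2 disj(1) assms(12) e nonneg _ c(2)]) (use less in simp)
    moreover have "c2 \<le> 0"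
      by (rule eigenfunction_union_coeff_nonpos[OF p2 p1 disj(2) assms(12) e' nonneg _ c(1)]) (use less in simp)
    \<comment> \<open>The combination is then the zero function, which no eigenfunction may
      be.\<close>
    ultimately have "c1 = 0" "c2 = 0" using c by auto
    then show False
      using e by (simp add: eigenfunction_def nonzero_fun_def)
  qed
  ultimately show ?thesis by blast
qed

end
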